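(* Let $S(\bar p,q)=\big[t(\bar p,q)=\mathbf 1\wedge\bigwedge_{k\le\kappa}s_k(\bar p,q)\neq\mathbf 1\big]$ be a system of degree $\le d$, with $\bar p=(p_1,\dots,p_l)$. For every $l$-tuple $\bar a$ in a Heyting algebra $A$, the system $S(\bar a,q)$ has a solution in some Heyting algebra extending $A$ if and only if $\Delta_t(\bar a)=\mathbf 1$ and $\nabla_{t,s_k}(\bar a)\neq\mathbf 1$ for every $k\le\kappa$.
   Context: $F(\bar p)\subseteq F(\bar p,q)$ are free Heyting algebras; IPC formulas are identified with their elements; degree = maximal nesting of $\to$. A system of degree $\le d$ means $t,s_k$ all have degree $\le d$; a solution of $S(\bar a,q)$ in $B\supseteq A$ is $b\in B$ with $t(\bar a,b)=\mathbf 1$ and $s_k(\bar a,b)\ne\mathbf 1$ for all $k$. $\mathrm{Es}(\bar p)$ is the set of prime filters of $F(\bar p)$; $[\![\varphi]\!]=\{x\in\mathrm{Es}(\bar p):\varphi\in x\}$. $x\sim_n y$ means $x,y$ contain the same formulas of degree $\le n$; $\delta_{\bar p}(x,y)=2^{-\min\{n:x\not\sim_n y\}}$, similarly $\delta_{\bar p,q}$ on $\mathrm{Es}(\bar p,q)$. The balls of radius $2^{-n}$ in $\mathrm{Es}(\bar p)$ are the $\sim_n$-classes; for each such ball $B$ a pair $(\varphi_B,\psi_B)$ of IPC formulas in $\bar p$ of degree $<n$ with $B=[\![\varphi_B]\!]\setminus[\![\psi_B]\!]$ is fixed. $R_{l,d}$ is a fixed integer such that for all $y\in\mathrm{Es}(\bar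 p)$, $x_0\in\mathrm{Es}(\bar p,q)$ with $\delta_{\bar p}(y,x_0\cap F(\bar p))<2^{-R_{l,d}}$ there is $x\in\mathrm{Es}(\bar p,q)$ with $x\cap F(\bar p)=y$ and $\delta_{\bar p,q}(x,x_0)<2^{-d}$ (such an integer exists). Discriminant: $\Delta_t(\bar p)=\bigwedge_{B\in\mathcal D_t}(\varphi_B(\bar p)\to\psi_B(\bar p))$, where $\mathcal D_t$ is the set of balls $B$ of radius $2^{-R_{l,d}}$ in $\mathrm{Es}(\bar p)$ with $t(\bar p,q)\wedge\varphi_B(\bar p)\le\psi_B(\bar p)$ in $F(\bar p,q)$. Co-discriminant: $\nabla_{t,s_k}(\bar p)=\bigwedge_{B\in\mathcal D'_{t,s_k}}(\varphi_B(\bar p)\to\psi_B(\bar p))$, where $\mathcal D'_{t,s_k}$ is the set of balls $B$ of radius $2^{-R_{l,d}}$ with $t(\bar p,q)\wedge\varphi_B(\bar p)\not\le s_k(\bar p,q)\vee\psi_B(\bar p)$ in $F(\bar p,q)$. *)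

theory Defs
  imports Complex_Main "HOL-Algebra.Lattice"
begin

section \<open>Heyting algebras\<close>

locale heyting_algebra = bounded_lattice L for L (structure) +
  assumes imp_exists:
    "\<lbrakk>a \<in> carrier L; b \<in> carrier L\<rbrakk> \<Longrightarrow> \<exists>c. greatest L c {x \<in> carrier L. x \<sqinter> a \<sqsubseteq> b}"

definition himp :: "[_, 'a, 'a] \<Rightarrow> 'a" (infixr \<open>\<rightarrow>\<^sub>H\<index>\<close> 60)
  where "a \<rightarrow>\<^sub>H\<^bsub>L\<^esub> b = (SOME c. greatest L c {x \<in> carrier L. x \<sqinter>\<^bsub>L\<^esub> a \<sqsubseteq>\<^bsub>L\<^esub> b})"

definition heyting_embedding ::
    "('a, 'm) gorder_scheme \<Rightarrow> ('b, 'n) gorder_scheme \<Rightarrow> ('a \<Rightarrow> 'b) \<Rightarrow> bool"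
  where "heyting_embedding A B f \<longleftrightarrow>
    f \<in> carrier A \<rightarrow> carrier B \<and> inj_on f (carrier A) \<and>
    f \<bottom>\<^bsub>A\<^esub> = \<bottom>\<^bsub>B\<^esub> \<and> f \<top>\<^bsub>A\<^esub> = \<top>\<^bsub>B\<^esub> \<and>
    (\<forall>x\<in>carrier A. \<forall>y\<in>carrier A.
       f (x \<sqinter>\<^bsub>A\<^esub> y) = f x \<sqinter>\<^bsub>B\<^esub> f y \<and>
       f (x \<squnion>\<^bsub>A\<^esub> y) = f x \<squnion>\<^bsub>B\<^esub> f y \<and>
       f (x \<rightarrow>\<^sub>H\<^bsub>A\<^esub> y) = f x \<rightarrow>\<^sub>H\<^bsub>B\<^esub> f y)"

definition prime_filter :: "('a, 'm) gorder_scheme \<Rightarrow> 'a set \<Rightarrow> bool"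
  where "prime_filter L x \<longleftrightarrow>
    x \<subseteq> carrier L \<and> x \<noteq> {} \<and> x \<noteq> carrier L \<and>
    (\<forall>u\<in>x. \<forall>v\<in>carrier L. u \<sqsubseteq>\<^bsub>L\<^esub> v \<longrightarrow> v \<in> x) \<and>
    (\<forall>u\<in>x. \<forall>v\<in>x. u \<sqinter>\<^bsub>L\<^esub> v \<in> x) \<and>
    (\<forall>u\<in>carrier L. \<forall>v\<in>carrier L. u \<squnion>\<^bsub>L\<^esub> v \<in> x \<longrightarrow> u \<in> x \<or> v \<in> x)"


section \<open>Intuitionistic propositional formulas\<close>

datatype 'v fm = Var 'v | Bot | Top
  | And "'v fm" "'v fm" | Or "'v fm" "'v fm" | Imp "'v fm" "'v fm"

primrec vars :: "'v fm \<Rightarrow> 'v set" where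
  "vars (Var i) = {i}"
| "vars Bot = {}"
| "vars Top = {}"
| "vars (And \<phi> \<psi>) = vars \<phi> \<union> vars \<psi>"
| "vars (Or \<phi> \<psi>) = vars \<phi> \<union> vars \<psi>"
| "vars (Imp \<phi> \<psi>) = vars \<phi> \<union> vars \<psi>"

primrec degree :: "'v fm \<Rightarrow> nat" where
  "degree (Var i) = 0"
| "degree Bot = 0"
| "degree Top = 0"
| "degree (And \<phi> \<psi>) = max (degree \<phi>) (degree \<psi>)"
| "degree (Or \<phi> \<psi>) = max (degree \<phi>) (degree \<psi>)"
| "degree (Imp \<phi> \<psi>) = Suc (max (degree \<phi>) (degree \<psi>))"

primrec ev :: "('a, 'm) gorder_scheme \<Rightarrow> ('v \<Rightarrow> 'a) \<Rightarrow> 'v fm \<Rightarrow> 'a" where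
  "ev L a (Var i) = a i"
| "ev L a Bot = \<bottom>\<^bsub>L\<^esub>"
| "ev L a Top = \<top>\<^bsub>L\<^esub>"
| "ev L a (And \<phi> \<psi>) = ev L a \<phi> \<sqinter>\<^bsub>L\<^esub> ev L a \<psi>"
| "ev L a (Or \<phi> \<psi>) = ev L a \<phi> \<squnion>\<^bsub>L\<^esub> ev L a \<psi>"
| "ev L a (Imp \<phi> \<psi>) = ev L a \<phi> \<rightarrow>\<^sub>H\<^bsub>L\<^esub> ev L a \<psi>"

inductive ipc :: "'v fm \<Rightarrow> bool" where
  K: "ipc (Imp \<phi> (Imp \<psi> \<phi>))"
| S: "ipc (Imp (Imp \<phi> (Imp \<psi> \<chi>)) (Imp (Imp \<phi> \<psi>) (Imp \<phi> \<chi>)))"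
| AndE1: "ipc (Imp (And \<phi> \<psi>) \<phi>)"
| AndE2: "ipc (Imp (And \<phi> \<psi>) \<psi>)"
| AndI: "ipc (Imp \<phi> (Imp \<psi> (And \<phi> \<psi>)))"
| OrI1: "ipc (Imp \<phi> (Or \<phi> \<psi>))"
| OrI2: "ipc (Imp \<psi> (Or \<phi> \<psi>))"
| OrE: "ipc (Imp (Imp \<phi> \<chi>) (Imp (Imp \<psi> \<chi>) (Imp (Or \<phi> \<psi>) \<chi>)))"
| BotE: "ipc (Imp Bot \<phi>)"
| TopI: "ipc Top"
| MP: "ipc (Imp \<phi> \<psi>) \<Longrightarrow> ipc \<phi> \<Longrightarrow> ipc \<psi>"


section \<open>Free Heyting algebras\<close>

text \<open>
  The free Heyting algebra on the generators \<open>Var 0, \<dots>, Var (n - 1)\<close> is the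
  Lindenbaum--Tarski algebra. The classes are formed in the set of all formulas, so that
  the algebra on \<open>l\<close> generators is literally a subset of the one on \<open>Suc l\<close> generators.
  The tuple \<open>p\<close> corresponds to \<open>Var 0, \<dots>, Var (l - 1)\<close>, and \<open>q\<close> to \<open>Var l\<close>.
\<close>

definition cls :: "'v fm \<Rightarrow> 'v fm set"
  where "cls \<phi> = {\<psi>. ipc (Imp \<phi> \<psi>) \<and> ipc (Imp \<psi> \<phi>)}"

definition formulas :: "nat \<Rightarrow> nat fm set"
  where "formulas n = {\<phi>. vars \<phi> \<subseteq> {..<n}}"

definition free_heyting :: "nat \<Rightarrow> nat fm set gorder"
  where "free_heyting n =
    \<lparr>carrier = cls ` formulas n, eq = (=),
     le = (\<lambda>X Y. \<exists>\<phi>\<in>X. \<exists>\<psi>\<in>Y. ipc (Imp \<phi> \<psi>))\<rparr>"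


section \<open>Spaces of prime filters\<close>

definition Es :: "nat \<Rightarrow> nat fm set set set"
  where "Es n = {x. prime_filter (free_heyting n) x}"

definition truth_set :: "nat \<Rightarrow> nat fm \<Rightarrow> nat fm set set set"
  where "truth_set n \<phi> = {x \<in> Es n. cls \<phi> \<in> x}"

definition sim :: "nat \<Rightarrow> nat \<Rightarrow> nat fm set set \<Rightarrow> nat fm set set \<Rightarrow> bool"
  where "sim n m x y \<longleftrightarrow>
    (\<forall>\<phi>\<in>formulas n. degree \<phi> \<le> m \<longrightarrow> (cls \<phi> \<in> x \<longleftrightarrow> cls \<phi> \<in> y))"

definition delta :: "nat \<Rightarrow> nat fm set set \<Rightarrow> nat fm set set \<Rightarrow> real"
  where "delta n x y =
    (if \<forall>m. sim n m x y then 0 else (1/2) ^ (LEAST m. \<not> sim n m x y))"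

definition balls :: "nat \<Rightarrow> nat \<Rightarrow> nat fm set set set set"
  where "balls n m = (\<lambda>x. {y \<in> Es n. delta n x y < (1/2) ^ m}) ` Es n"

definition lifting_bound :: "nat \<Rightarrow> nat \<Rightarrow> nat \<Rightarrow> bool"
  where "lifting_bound l d R \<longleftrightarrow>
    (\<forall>y\<in>Es l. \<forall>x\<^sub>0\<in>Es (Suc l).
       delta l y (x\<^sub>0 \<inter> carrier (free_heyting l)) < (1/2) ^ R \<longrightarrow>
       (\<exists>x\<in>Es (Suc l). x \<inter> carrier (free_heyting l) = y \<and> delta (Suc l) x x\<^sub>0 < (1/2) ^ d))"

text \<open>
  The formulas attached to the balls of radius \<open>2\<^sup>-\<^sup>m\<close> have degree at most \<open>m\<close>:
  these balls are the classes of \<open>sim n m\<close>, and formulas of degree less than \<open>m\<close>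
  do not separate them in general.
\<close>

definition ball_formulas ::
    "nat \<Rightarrow> nat \<Rightarrow> (nat fm set set set \<Rightarrow> nat fm) \<Rightarrow> (nat fm set set set \<Rightarrow> nat fm) \<Rightarrow> bool"
  where "ball_formulas n m \<phi> \<psi> \<longleftrightarrow>
    (\<forall>B\<in>balls n m.
       \<phi> B \<in> formulas n \<and> degree (\<phi> B) \<le> m \<and>
       \<psi> B \<in> formulas n \<and> degree (\<psi> B) \<le> m \<and>
       B = truth_set n (\<phi> B) - truth_set n (\<psi> B))"


section \<open>Discriminant and co-discriminant\<close>

definition big_and :: "'v fm set \<Rightarrow> 'v fm"
  where "big_and \<Gamma> = foldr And (SOME \<phi>s. distinct \<phi>s \<and> set \<phi>s = \<Gamma>) Top"

definition discriminant ::
    "nat \<Rightarrow> nat \<Rightarrow> (nat fm set set set \<Rightarrow> nat fm) \<Rightarrow> (nat fm set set set \<Rightarrow> nat fm) \<Rightarrow>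
     nat fm \<Rightarrow> nat fm"
  where "discriminant l R \<phi> \<psi> t =
    big_and ((\<lambda>B. Imp (\<phi> B) (\<psi> B)) `
      {B \<in> balls l R. cls (And t (\<phi> B)) \<sqsubseteq>\<^bsub>free_heyting (Suc l)\<^esub> cls (\<psi> B)})"

definition codiscriminant ::
    "nat \<Rightarrow> nat \<Rightarrow> (nat fm set set set \<Rightarrow> nat fm) \<Rightarrow> (nat fm set set set \<Rightarrow> nat fm) \<Rightarrow>
     nat fm \<Rightarrow> nat fm \<Rightarrow> nat fm"
  where "codiscriminant l R \<phi> \<psi> t s =
    big_and ((\<lambda>B. Imp (\<phi> B) (\<psi> B)) `
      {B \<in> balls l R. \<not> cls (And t (\<phi> B)) \<sqsubseteq>\<^bsub>free_heyting (Suc l)\<^esub> cls (Or s (\<psi> B))})"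


section \<open>Systems and their solutions\<close>

definition system_of_degree :: "nat \<Rightarrow> nat \<Rightarrow> nat fm \<Rightarrow> nat \<Rightarrow> (nat \<Rightarrow> nat fm) \<Rightarrow> bool"
  where "system_of_degree l d t \<kappa> s \<longleftrightarrow>
    t \<in> formulas (Suc l) \<and> degree t \<le> d \<and>
    (\<forall>k\<in>{1..\<kappa>}. s k \<in> formulas (Suc l) \<and> degree (s k) \<le> d)"

definition solution ::
    "('b, 'n) gorder_scheme \<Rightarrow> nat \<Rightarrow> (nat \<Rightarrow> 'b) \<Rightarrow> nat fm \<Rightarrow> nat \<Rightarrow> (nat \<Rightarrow> nat fm) \<Rightarrow> 'b \<Rightarrow> bool"
  where "solution B l a t \<kappa> s b \<longleftrightarrow>
    b \<in> carrier B \<and> ev B (a(l := b)) t = \<top>\<^bsub>B\<^esub> \<and>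
    (\<forall>k\<in>{1..\<kappa>}. ev B (a(l := b)) (s k) \<noteq> \<top>\<^bsub>B\<^esub>)"

text \<open>
  An extension of \<open>A\<close> is a Heyting algebra \<open>B\<close> together with an embedding of \<open>A\<close> into \<open>B\<close>.
  The first argument is the type in which the elements of \<open>B\<close> are taken. Since one cannot
  quantify existentially over types, the theorem pairs two facts: an extension over an
  arbitrary type with a solution forces the conditions on the discriminants, and these
  conditions provide an extension over the type \<open>'a option fm set\<close> of sets of formulas
  with variables in \<open>A\<close> and one additional variable.
\<close>

definition solvable_in_extension ::
    "'b itself \<Rightarrow> ('a, 'm) gorder_scheme \<Rightarrow> nat \<Rightarrow> (nat \<Rightarrow> 'a) \<Rightarrow>
     nat fm \<Rightarrow> nat \<Rightarrow> (nat \<Rightarrow> nat fm) \<Rightarrow> bool"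
  where "solvable_in_extension T A l a t \<kappa> s \<longleftrightarrow>
    (\<exists>(B :: 'b gorder) f b.
       heyting_algebra B \<and> heyting_embedding A B f \<and> solution B l (f \<circ> a) t \<kappa> s b)"


section \<open>Consistency of the definitions\<close>

lemma sim_mono: "sim n m x y \<Longrightarrow> k \<le> m \<Longrightarrow> sim n k x y"
  by (auto simp: sim_def)

lemma delta_less_iff: "delta n x y < (1/2) ^ m \<longleftrightarrow> sim n m x y"
proof (cases "\<forall>m. sim n m x y")
  case True
  then show ?thesis by (simp add: delta_def)
next
  case False
  define k where "k = (LEAST m. \<not> sim n m x y)"
  have k: "\<not> sim n k x y"
    unfolding k_def using False by (metis LeastI)
  have below: "sim n j x y" if "j < k" for j
    using not_less_Least that unfolding k_def by blast
  have "delta n x y = (1/2) ^ k"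
    using False by (auto simp: delta_def k_def)
  moreover have "((1/2 :: real) ^ k < (1/2) ^ m) \<longleftrightarrow> m < k"
    by (rule power_strict_decreasing_iff) auto
  moreover have "sim n m x y \<longleftrightarrow> m < k"
    using k below sim_mono[of n m x y k] by (meson not_less)
  ultimately show ?thesis by simp
qed

lemma balls_eq_sim_classes: "balls n m = (\<lambda>x. {y \<in> Es n. sim n m x y}) ` Es n"
  by (simp add: balls_def delta_less_iff)

lemma ipc_refl: "ipc (Imp \<phi> \<phi>)"
  by (meson K S MP)

lemma ipc_trans: "ipc (Imp \<phi> \<psi>) \<Longrightarrow> ipc (Imp \<psi> \<chi>) \<Longrightarrow> ipc (Imp \<phi> \<chi>)"
  by (meson K S MP)

lemma ipc_And: "ipc (Imp \<chi> (And \<phi> \<psi>)) \<longleftrightarrow> ipc (Imp \<chi> \<phi>) \<and> ipc (Imp \<chi> \<psi>)"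
proof
  assume "ipc (Imp \<chi> (And \<phi> \<psi>))"
  then show "ipc (Imp \<chi> \<phi>) \<and> ipc (Imp \<chi> \<psi>)"
    using AndE1 AndE2 ipc_trans by blast
next
  assume *: "ipc (Imp \<chi> \<phi>) \<and> ipc (Imp \<chi> \<psi>)"
  then have "ipc (Imp \<chi> (Imp \<psi> (And \<phi> \<psi>)))"
    using AndI ipc_trans by blast
  with * show "ipc (Imp \<chi> (And \<phi> \<psi>))"
    by (meson S MP)
qed

lemma ipc_Or: "ipc (Imp (Or \<phi> \<psi>) \<chi>) \<longleftrightarrow> ipc (Imp \<phi> \<chi>) \<and> ipc (Imp \<psi> \<chi>)"
  by (meson MP OrE OrI1 OrI2 ipc_trans)

lemma ipc_Imp: "ipc (Imp \<chi> (Imp \<phi> \<psi>)) \<longleftrightarrow> ipc (Imp (And \<chi> \<phi>) \<psi>)"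
proof
  assume "ipc (Imp \<chi> (Imp \<phi> \<psi>))"
  then have "ipc (Imp (And \<chi> \<phi>) (Imp \<phi> \<psi>))"
    using AndE1 ipc_trans by blast
  then show "ipc (Imp (And \<chi> \<phi>) \<psi>)"
    by (meson S MP AndE2)
next
  assume "ipc (Imp (And \<chi> \<phi>) \<psi>)"
  then have "ipc (Imp (Imp \<phi> (And \<chi> \<phi>)) (Imp \<phi> \<psi>))"
    by (meson K S MP)
  then show "ipc (Imp \<chi> (Imp \<phi> \<psi>))"
    using AndI ipc_trans by blast
qed

lemma ipc_Top: "ipc (Imp \<phi> Top)"
  by (meson K MP TopI)

lemma cls_eq_iff: "cls \<phi> = cls \<psi> \<longleftrightarrow> ipc (Imp \<phi> \<psi>) \<and> ipc (Imp \<psi> \<phi>)"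
  unfolding cls_def set_eq_iff mem_Collect_eq by (meson ipc_refl ipc_trans)

lemma free_le_iff: "cls \<phi> \<sqsubseteq>\<^bsub>free_heyting n\<^esub> cls \<psi> \<longleftrightarrow> ipc (Imp \<phi> \<psi>)"
  by (simp add: free_heyting_def cls_def) (meson ipc_refl ipc_trans)

lemma free_carrier: "carrier (free_heyting n) = cls ` formulas n"
  by (simp add: free_heyting_def)

lemma free_heyting_mono: "carrier (free_heyting n) \<subseteq> carrier (free_heyting (Suc n))"
  by (force simp: free_carrier formulas_def)

lemma formulas_simps [simp]:
  "Bot \<in> formulas n" "Top \<in> formulas n" "Var i \<in> formulas n \<longleftrightarrow> i < n"
  "And \<phi> \<psi> \<in> formulas n \<longleftrightarrow> \<phi> \<in> formulas n \<and> \<psi> \<in> formulas n"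
  "Or \<phi> \<psi> \<in> formulas n \<longleftrightarrow> \<phi> \<in> formulas n \<and> \<psi> \<in> formulas n"
  "Imp \<phi> \<psi> \<in> formulas n \<longleftrightarrow> \<phi> \<in> formulas n \<and> \<psi> \<in> formulas n"
  by (auto simp: formulas_def)

lemma partial_order_free_heyting: "partial_order (free_heyting n)"
proof -
  have eq: "(.=\<^bsub>free_heyting n\<^esub>) = (=)"
    by (simp add: free_heyting_def)
  show ?thesis
    by unfold_locales
      (auto simp: eq free_carrier free_le_iff ipc_refl intro: ipc_trans,
        auto simp: cls_def intro: ipc_trans)
qed

lemma free_glb:
  assumes "\<phi> \<in> formulas n" "\<psi> \<in> formulas n"
  shows "is_glb (free_heyting n) (cls (And \<phi> \<psi>)) {cls \<phi>, cls \<psi>}"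
  using assms AndE1 AndE2
  by (auto simp: greatest_def Lower_def free_carrier free_le_iff ipc_And)

lemma free_lub:
  assumes "\<phi> \<in> formulas n" "\<psi> \<in> formulas n"
  shows "is_lub (free_heyting n) (cls (Or \<phi> \<psi>)) {cls \<phi>, cls \<psi>}"
  using assms OrI1 OrI2
  by (auto simp: least_def Upper_def free_carrier free_le_iff ipc_Or)

lemma bounded_lattice_free_heyting: "bounded_lattice (free_heyting n)"
proof -
  interpret partial_order "free_heyting n"
    by (rule partial_order_free_heyting)
  show ?thesis
  proof
    show "\<exists>x. least (free_heyting n) x (carrier (free_heyting n))"
      by (rule exI[of _ "cls Bot"]) (auto simp: least_def free_carrier free_le_iff BotE)
    show "\<exists>x. greatest (free_heyting n) x (carrier (free_heyting n))"
      by (rule exI[of _ "cls Top"]) (auto simp: greatest_def free_carrier free_le_iff ipc_Top)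
  qed (auto simp: free_carrier intro: free_glb free_lub)
qed

lemma free_meet:
  assumes "\<phi> \<in> formulas n" "\<psi> \<in> formulas n"
  shows "cls \<phi> \<sqinter>\<^bsub>free_heyting n\<^esub> cls \<psi> = cls (And \<phi> \<psi>)"
proof -
  interpret bounded_lattice "free_heyting n"
    by (rule bounded_lattice_free_heyting)
  show ?thesis
    unfolding meet_def inf_def
    using free_glb[OF assms] greatest_unique by (metis (no_types, lifting) someI_ex)
qed

theorem heyting_algebra_free_heyting: "heyting_algebra (free_heyting n)"
proof -
  interpret bounded_lattice "free_heyting n"
    by (rule bounded_lattice_free_heyting)
  show ?thesis
  proof
    fix a b assume "a \<in> carrier (free_heyting n)" "b \<in> carrier (free_heyting n)"
    then obtain \<phi> \<psi> where *: "\<phi> \<in> formulas n" "\<psi> \<in> formulas n" "a = cls \<phi>" "b = cls \<psi>"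
      by (auto simp: free_carrier)
    have "greatest (free_heyting n) (cls (Imp \<phi> \<psi>))
      {x \<in> carrier (free_heyting n). x \<sqinter>\<^bsub>free_heyting n\<^esub> a \<sqsubseteq>\<^bsub>free_heyting n\<^esub> b}"
      using * by (auto simp: greatest_def free_carrier free_meet free_le_iff
          ipc_refl simp flip: ipc_Imp)
    then show "\<exists>c. greatest (free_heyting n) c
      {x \<in> carrier (free_heyting n). x \<sqinter>\<^bsub>free_heyting n\<^esub> a \<sqsubseteq>\<^bsub>free_heyting n\<^esub> b}" ..
  qed
qed

end

theory Submission
  imports Defs "HOL-Library.Product_Order"
begin

text \<open>
  Necessity: an inequality between formulas in \<open>F(p, q)\<close> is preserved by evaluation, which gives
  the discriminant. If \<open>s\<^sub>k(a, b) \<noteq> 1\<close>, a prime filter of the extension that omits it pulls back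
  to a point of \<open>Es(p, q)\<close>, and the ball around its restriction to \<open>F(p)\<close> contributes to the
  co-discriminant a conjunct that fails.

  Sufficiency: consider pairs \<open>(x, y)\<close> of a prime filter \<open>x\<close> of \<open>A\<close> and a point \<open>y \<ni> t\<close> of
  \<open>Es(p, q)\<close> that induce the same point of \<open>Es(p)\<close>, ordered by inclusion. Both projections lift
  inclusions, so membership in \<open>x\<close> interprets \<open>A\<close> as a Heyting algebra in the upsets of this
  frame and membership in \<open>y\<close> computes the value of every formula at \<open>(a, q)\<close>; this is the
  construction of the amalgam over the subalgebra generated by \<open>a\<close>. The discriminant and the
  lifting bound provide a \<open>y\<close> for each \<open>x\<close>, which makes \<open>A\<close> embed; the co-discriminant provides
  a pair with \<open>s\<^sub>k \<notin> y\<close>.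
\<close>

subsection \<open>Prime filters of Heyting algebras\<close>

context heyting_algebra
begin

lemma le_meet_iff:
  "\<lbrakk>x \<in> carrier L; y \<in> carrier L; z \<in> carrier L\<rbrakk> \<Longrightarrow> z \<sqsubseteq> x \<sqinter> y \<longleftrightarrow> z \<sqsubseteq> x \<and> z \<sqsubseteq> y"
  by (meson le_trans meet_closed meet_le meet_left meet_right)

lemma join_le_iff:
  "\<lbrakk>x \<in> carrier L; y \<in> carrier L; z \<in> carrier L\<rbrakk> \<Longrightarrow> x \<squnion> y \<sqsubseteq> z \<longleftrightarrow> x \<sqsubseteq> z \<and> y \<sqsubseteq> z"
  by (meson le_trans join_closed join_le join_left join_right)

lemma meet_eqI:
  assumes "x \<in> carrier L" "y \<in> carrier L" "c \<in> carrier L"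
    and "\<And>z. z \<in> carrier L \<Longrightarrow> z \<sqsubseteq> c \<longleftrightarrow> z \<sqsubseteq> x \<and> z \<sqsubseteq> y"
  shows "x \<sqinter> y = c"
proof (rule le_antisym)
  show "x \<sqinter> y \<sqsubseteq> c" using assms(4)[of "x \<sqinter> y"] assms(1,2) meet_left meet_right by simp
  show "c \<sqsubseteq> x \<sqinter> y" using assms(4)[of c] assms(1-3) by (simp add: le_meet_iff)
qed (use assms in auto)

lemma join_eqI:
  assumes "x \<in> carrier L" "y \<in> carrier L" "c \<in> carrier L"
    and "\<And>z. z \<in> carrier L \<Longrightarrow> c \<sqsubseteq> z \<longleftrightarrow> x \<sqsubseteq> z \<and> y \<sqsubseteq> z"
  shows "x \<squnion> y = c"
proof (rule le_antisym)
  show "c \<sqsubseteq> x \<squnion> y" using assms(4)[of "x \<squnion> y"] assms(1,2) join_left join_right by simp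
  show "x \<squnion> y \<sqsubseteq> c" using assms(4)[of c] assms(1-3) by (simp add: join_le_iff)
qed (use assms in auto)

lemma meet_idem: "x \<in> carrier L \<Longrightarrow> x \<sqinter> x = x"
  by (rule meet_eqI) auto

lemma join_idem: "x \<in> carrier L \<Longrightarrow> x \<squnion> x = x"
  by (rule join_eqI) auto

lemma himp_greatest:
  assumes "a \<in> carrier L" "b \<in> carrier L"
  shows "greatest L (a \<rightarrow>\<^sub>H b) {x \<in> carrier L. x \<sqinter> a \<sqsubseteq> b}"
  unfolding himp_def using imp_exists[OF assms] by (rule someI_ex)

lemma himp_closed [simp]:
  "\<lbrakk>a \<in> carrier L; b \<in> carrier L\<rbrakk> \<Longrightarrow> a \<rightarrow>\<^sub>H b \<in> carrier L"
  using himp_greatest by (auto simp: greatest_def)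

lemma le_himp_iff:
  assumes "a \<in> carrier L" "b \<in> carrier L" "x \<in> carrier L"
  shows "x \<sqsubseteq> a \<rightarrow>\<^sub>H b \<longleftrightarrow> x \<sqinter> a \<sqsubseteq> b"
proof
  have le: "(a \<rightarrow>\<^sub>H b) \<sqinter> a \<sqsubseteq> b"
    using himp_greatest[OF assms(1,2)] by (auto simp: greatest_def)
  assume *: "x \<sqsubseteq> a \<rightarrow>\<^sub>H b"
  have "x \<sqinter> a \<sqsubseteq> (a \<rightarrow>\<^sub>H b) \<sqinter> a"
    using assms le_trans[OF meet_left *] meet_right by (simp add: le_meet_iff)
  then show "x \<sqinter> a \<sqsubseteq> b"
    by (rule le_trans[OF _ le]) (use assms in simp_all)
next
  assume "x \<sqinter> a \<sqsubseteq> b"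
  then show "x \<sqsubseteq> a \<rightarrow>\<^sub>H b"
    using himp_greatest[OF assms(1,2)] assms(3) by (auto simp: greatest_def)
qed

lemma himp_eqI:
  assumes "a \<in> carrier L" "b \<in> carrier L" "c \<in> carrier L"
    and "\<And>z. z \<in> carrier L \<Longrightarrow> z \<sqsubseteq> c \<longleftrightarrow> z \<sqinter> a \<sqsubseteq> b"
  shows "a \<rightarrow>\<^sub>H b = c"
proof (rule le_antisym)
  show "a \<rightarrow>\<^sub>H b \<sqsubseteq> c"
    using assms(1,2) assms(4)[of "a \<rightarrow>\<^sub>H b"] by (simp flip: le_himp_iff)
  show "c \<sqsubseteq> a \<rightarrow>\<^sub>H b" using assms(4)[of c] assms(1-3) by (simp add: le_himp_iff)
qed (use assms in auto)

lemma himp_meet_le: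
  "\<lbrakk>a \<in> carrier L; b \<in> carrier L\<rbrakk> \<Longrightarrow> (a \<rightarrow>\<^sub>H b) \<sqinter> a \<sqsubseteq> b"
  using le_himp_iff[of a b "a \<rightarrow>\<^sub>H b"] by simp

lemma himp_mono:
  assumes "a \<in> carrier L" "b \<in> carrier L" "c \<in> carrier L" "b \<sqsubseteq> c"
  shows "a \<rightarrow>\<^sub>H b \<sqsubseteq> a \<rightarrow>\<^sub>H c"
proof -
  have "(a \<rightarrow>\<^sub>H b) \<sqinter> a \<sqsubseteq> c"
    by (rule le_trans[OF himp_meet_le \<open>b \<sqsubseteq> c\<close>]) (use assms in simp_all)
  then show ?thesis using assms by (simp add: le_himp_iff)
qed

text \<open>Together with \<open>himp_mono\<close> this makes
  \<open>{w. a \<rightarrow>\<^sub>H w \<in> F}\<close> a filter for every filter \<open>F\<close>;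
  it is the filter generated by \<open>F\<close> and \<open>a\<close>, and both Zorn's argument and
  the clause for implication rest on it.\<close>

lemma himp_meet_distrib:
  assumes "a \<in> carrier L" "b \<in> carrier L" "c \<in> carrier L"
  shows "(a \<rightarrow>\<^sub>H b) \<sqinter> (a \<rightarrow>\<^sub>H c) \<sqsubseteq> a \<rightarrow>\<^sub>H b \<sqinter> c"
proof -
  let ?m = "(a \<rightarrow>\<^sub>H b) \<sqinter> (a \<rightarrow>\<^sub>H c)"
  have "?m \<sqsubseteq> a \<rightarrow>\<^sub>H b" "?m \<sqsubseteq> a \<rightarrow>\<^sub>H c"
    using assms by (auto intro: meet_left meet_right)
  then show ?thesis
    using assms by (simp add: le_himp_iff le_meet_iff)
qed

section \<open>Prime filters and their separation theorem\<close>

lemma prime_filterD: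
  assumes "prime_filter L x"
  shows "u \<in> x \<Longrightarrow> u \<in> carrier L"
    and "u \<in> x \<Longrightarrow> u \<sqsubseteq> v \<Longrightarrow> v \<in> carrier L \<Longrightarrow> v \<in> x"
  using assms unfolding prime_filter_def by blast+

lemma prime_filter_top:
  assumes "prime_filter L x" shows "\<top> \<in> x"
proof -
  obtain u where "u \<in> x" using assms unfolding prime_filter_def by blast
  then show ?thesis
    using prime_filterD[OF assms] top_higher top_closed by blast
qed

lemma prime_filter_bottom:
  assumes "prime_filter L x" shows "\<bottom> \<notin> x"
proof
  assume "\<bottom> \<in> x"
  then have "carrier L \<subseteq> x" using prime_filterD(2)[OF assms] bottom_lower by blast
  then show False using assms unfolding prime_filter_def by blast
qed

lemma prime_filter_meet:
  assumes "prime_filter L x" "u \<in> carrier L" "v \<in> carrier L"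
  shows "u \<sqinter> v \<in> x \<longleftrightarrow> u \<in> x \<and> v \<in> x"
proof
  assume "u \<sqinter> v \<in> x"
  then show "u \<in> x \<and> v \<in> x"
    using prime_filterD(2)[OF assms(1)] meet_left meet_right assms(2,3) by blast
qed (use assms[unfolded prime_filter_def] in blast)

lemma prime_filter_join:
  assumes "prime_filter L x" "u \<in> carrier L" "v \<in> carrier L"
  shows "u \<squnion> v \<in> x \<longleftrightarrow> u \<in> x \<or> v \<in> x"
proof
  assume "u \<in> x \<or> v \<in> x"
  then show "u \<squnion> v \<in> x"
    using prime_filterD(2)[OF assms(1)] join_left join_right join_closed assms(2,3) by blast
qed (use assms[unfolded prime_filter_def] in blast)

text \<open>\<open>P\<close> and \<open>Q\<close> are asked to be closed under binary meets and
  joins, so that bases of a filter and of an ideal may be supplied. Zorn's lemma gives a filter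
  maximal among those that contain \<open>P\<close> and avoid \<open>Q\<close>; residuation makes it
  prime.\<close>

theorem prime_separation:
  assumes P: "P \<subseteq> carrier L" "P \<noteq> {}" "\<And>u v. u \<in> P \<Longrightarrow> v \<in> P \<Longrightarrow> u \<sqinter> v \<in> P"
    and Q: "Q \<subseteq> carrier L" "Q \<noteq> {}" "\<And>u v. u \<in> Q \<Longrightarrow> v \<in> Q \<Longrightarrow> u \<squnion> v \<in> Q"
    and PQ: "\<And>u v. u \<in> P \<Longrightarrow> v \<in> Q \<Longrightarrow> \<not> u \<sqsubseteq> v"
  obtains x where "prime_filter L x" "P \<subseteq> x" "x \<inter> Q = {}"
proof -
  define \<F> where "\<F> = {F. F \<subseteq> carrier L \<and> P \<subseteq> F \<and> F \<inter> Q = {} \<and>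
     (\<forall>u\<in>F. \<forall>v\<in>carrier L. u \<sqsubseteq> v \<longrightarrow> v \<in> F) \<and> (\<forall>u\<in>F. \<forall>v\<in>F. u \<sqinter> v \<in> F)}"
  \<comment> \<open>The filter generated by \<open>P\<close> shows that the family is nonempty; it
    avoids \<open>Q\<close> by \<open>PQ\<close>.\<close>
  have "{w \<in> carrier L. \<exists>p\<in>P. p \<sqsubseteq> w} \<in> \<F>"
  proof -
    have "\<exists>p\<in>P. p \<sqsubseteq> u \<sqinter> v"
      if uv: "u \<in> carrier L" "v \<in> carrier L" and pq: "p \<in> P" "p \<sqsubseteq> u" "q \<in> P" "q \<sqsubseteq> v" for u v p q
    proof
      have c: "p \<in> carrier L" "q \<in> carrier L" using P(1) pq by auto
      have "p \<sqinter> q \<sqsubseteq> u" using le_trans[OF meet_left pq(2)] c uv by simp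
      moreover have "p \<sqinter> q \<sqsubseteq> v" using le_trans[OF meet_right pq(4)] c uv by simp
      ultimately show "p \<sqinter> q \<sqsubseteq> u \<sqinter> v" using c uv by (simp add: le_meet_iff)
    qed (use P(3) pq in blast)
    moreover have "\<exists>p\<in>P. p \<sqsubseteq> v"
      if "u \<in> carrier L" "v \<in> carrier L" "p \<in> P" "p \<sqsubseteq> u" "u \<sqsubseteq> v" for u v p
      using that P(1) le_trans[of p u v] by blast
    moreover have "P \<subseteq> {w \<in> carrier L. \<exists>p\<in>P. p \<sqsubseteq> w}"
      using P(1) le_refl by blast
    ultimately show ?thesis
      using PQ unfolding \<F>_def by (simp (no_asm_simp)) blast
  qed
  then have "\<F> \<noteq> {}" by blast
  then have "\<exists>M\<in>\<F>. \<forall>X\<in>\<F>. M \<subseteq> X \<longrightarrow> X = M"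
  proof (rule subset_Zorn_nonempty)
    fix C assume C: "C \<noteq> {}" "subset.chain \<F> C"
    then have sub: "C \<subseteq> \<F>" and lin: "\<And>F G. F \<in> C \<Longrightarrow> G \<in> C \<Longrightarrow> F \<subseteq> G \<or> G \<subseteq> F"
      by (auto simp: subset_chain_def)
    have "u \<sqinter> v \<in> \<Union>C" if "u \<in> \<Union>C" "v \<in> \<Union>C" for u v
    proof -
      from that obtain F where "F \<in> C" "u \<in> F" "v \<in> F"
        using lin by blast
      moreover from this sub have "u \<sqinter> v \<in> F" by (auto simp: \<F>_def)
      ultimately show ?thesis by blast
    qed
    moreover have "\<Union>C \<subseteq> carrier L" "P \<subseteq> \<Union>C" "\<Union>C \<inter> Q = {}"
      "\<forall>u\<in>\<Union>C. \<forall>v\<in>carrier L. u \<sqsubseteq> v \<longrightarrow> v \<in> \<Union>C"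
      using sub C(1) unfolding \<F>_def by blast+
    ultimately show "\<Union>C \<in> \<F>" by (auto simp: \<F>_def)
  qed
  then obtain M where M: "M \<in> \<F>" and max: "\<And>X. X \<in> \<F> \<Longrightarrow> M \<subseteq> X \<Longrightarrow> X = M" by blast
  have Mc: "M \<subseteq> carrier L" and PM: "P \<subseteq> M" and MQ: "M \<inter> Q = {}"
    and up: "\<And>u v. u \<in> M \<Longrightarrow> v \<in> carrier L \<Longrightarrow> u \<sqsubseteq> v \<Longrightarrow> v \<in> M"
    and meet: "\<And>u v. u \<in> M \<Longrightarrow> v \<in> M \<Longrightarrow> u \<sqinter> v \<in> M"
    using M by (auto simp: \<F>_def)
  \<comment> \<open>The filter generated by \<open>M\<close> and \<open>u\<close> is \<open>{w. u \<rightarrow> w \<in> M}\<close>; by maximality it meets \<open>Q\<close>.\<close>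
  have ext: "\<exists>q\<in>Q. u \<rightarrow>\<^sub>H q \<in> M" if u: "u \<in> carrier L" "u \<notin> M" for u
  proof (rule ccontr)
    assume no: "\<not> ?thesis"
    let ?N = "{w \<in> carrier L. u \<rightarrow>\<^sub>H w \<in> M}"
    have sub: "M \<subseteq> ?N"
    proof
      fix w assume w: "w \<in> M"
      then have "w \<sqsubseteq> u \<rightarrow>\<^sub>H w"
        using u Mc meet_left[of w u] by (simp add: le_himp_iff subset_iff)
      then show "w \<in> ?N" using w u Mc up by auto
    qed
    have "u \<rightarrow>\<^sub>H w \<sqinter> w' \<in> M" if "w \<in> ?N" "w' \<in> ?N" for w w'
      using that u meet up[OF _ _ himp_meet_distrib] by auto
    moreover have "\<forall>w\<in>?N. \<forall>v\<in>carrier L. w \<sqsubseteq> v \<longrightarrow> v \<in> ?N"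
      using u by (auto intro: up[OF _ _ himp_mono])
    ultimately have "?N \<in> \<F>"
      using sub PM no by (auto simp: \<F>_def)
    then have "?N = M" using max sub by blast
    moreover have "u \<in> ?N"
    proof -
      obtain p where "p \<in> M" using PM P(2) by blast
      moreover from this have "p \<sqsubseteq> u \<rightarrow>\<^sub>H u"
        using Mc u meet_right[of p u] by (simp add: le_himp_iff subset_iff)
      ultimately show ?thesis using u up by auto
    qed
    ultimately show False using u by simp
  qed
  have "u \<in> M \<or> v \<in> M" if uv: "u \<in> carrier L" "v \<in> carrier L" "u \<squnion> v \<in> M" for u v
  proof (rule ccontr)
    assume "\<not> ?thesis"
    then obtain q r where qr: "q \<in> Q" "u \<rightarrow>\<^sub>H q \<in> M" "r \<in> Q" "v \<rightarrow>\<^sub>H r \<in> M"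
      using ext uv by blast
    let ?s = "q \<squnion> r" and ?m = "(u \<rightarrow>\<^sub>H q) \<sqinter> (v \<rightarrow>\<^sub>H r)"
    have c: "q \<in> carrier L" "r \<in> carrier L" using qr Q(1) by auto
    have "?m \<sqsubseteq> u \<rightarrow>\<^sub>H ?s" "?m \<sqsubseteq> v \<rightarrow>\<^sub>H ?s"
      using uv c le_trans[OF meet_left himp_mono[OF uv(1) c(1) _ join_left]]
        le_trans[OF meet_right himp_mono[OF uv(2) c(2) _ join_right]] by simp_all
    then have "u \<sqinter> ?m \<sqsubseteq> ?s" "v \<sqinter> ?m \<sqsubseteq> ?s"
      using uv c by (auto simp: le_himp_iff meet_comm[of _ u] meet_comm[of _ v])
    \<comment> \<open>Residuation replaces distributivity: \<open>u\<close> and \<open>v\<close> are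
      both below \<open>?m \<rightarrow>\<^sub>H ?s\<close>, hence so is their join.\<close>
    then have "(u \<squnion> v) \<sqinter> ?m \<sqsubseteq> ?s"
      using uv c by (simp add: join_le_iff flip: le_himp_iff)
    moreover have "(u \<squnion> v) \<sqinter> ?m \<in> M" using uv qr meet by blast
    ultimately have "?s \<in> M" using up c by auto
    then show False using MQ Q(3) qr by blast
  qed
  moreover have "M \<noteq> {}" "M \<noteq> carrier L" using PM P(2) MQ Q(1,2) by auto
  ultimately have "prime_filter L M"
    using Mc up meet unfolding prime_filter_def by blast
  then show thesis using PM MQ that by blast
qed

text \<open>This is the Kripke clause for implication on the poset of prime filters. From right to
  left, the filter \<open>{w. a \<rightarrow>\<^sub>H w \<in> x}\<close> generated by
  \<open>x\<close> and \<open>a\<close> has no element below \<open>b\<close> if the implication is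
  not in \<open>x\<close>, and separating it from \<open>b\<close> gives a counterexample
  \<open>y\<close>.\<close>

lemma prime_filter_himp:
  assumes x: "prime_filter L x" and ab: "a \<in> carrier L" "b \<in> carrier L"
  shows "a \<rightarrow>\<^sub>H b \<in> x \<longleftrightarrow> (\<forall>y. prime_filter L y \<longrightarrow> x \<subseteq> y \<longrightarrow> a \<in> y \<longrightarrow> b \<in> y)"
proof
  assume *: "a \<rightarrow>\<^sub>H b \<in> x"
  show "\<forall>y. prime_filter L y \<longrightarrow> x \<subseteq> y \<longrightarrow> a \<in> y \<longrightarrow> b \<in> y"
  proof (intro allI impI)
    fix y assume y: "prime_filter L y" "x \<subseteq> y" "a \<in> y"
    then have "(a \<rightarrow>\<^sub>H b) \<sqinter> a \<in> y" using * ab by (auto simp: prime_filter_meet)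
    then show "b \<in> y" using prime_filterD(2)[OF y(1)] himp_meet_le ab by blast
  qed
next
  assume *: "\<forall>y. prime_filter L y \<longrightarrow> x \<subseteq> y \<longrightarrow> a \<in> y \<longrightarrow> b \<in> y"
  show "a \<rightarrow>\<^sub>H b \<in> x"
  proof (rule ccontr)
    assume no: "a \<rightarrow>\<^sub>H b \<notin> x"
    let ?P = "{w \<in> carrier L. a \<rightarrow>\<^sub>H w \<in> x}"
    have aa: "a \<rightarrow>\<^sub>H w \<in> x" if "u \<in> x" "w \<in> carrier L" "u \<sqinter> a \<sqsubseteq> w" for u w
      using prime_filterD[OF x] that ab by (meson himp_closed le_himp_iff)
    have sub: "x \<subseteq> ?P"
      using prime_filterD(1)[OF x] ab aa[OF _ _ meet_left] by blast
    have aP: "a \<in> ?P"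
      using aa[OF prime_filter_top[OF x]] ab by (auto intro: meet_right)
    have meet: "w \<sqinter> w' \<in> ?P" if "w \<in> ?P" "w' \<in> ?P" for w w'
      using that ab x prime_filterD(2)[OF x _ himp_meet_distrib] by (auto simp: prime_filter_meet)
    have nle: "\<not> w \<sqsubseteq> b" if "w \<in> ?P" for w
      using that no ab prime_filterD(2)[OF x _ himp_mono[OF ab(1) _ ab(2)], of w] by auto
    obtain y where "prime_filter L y" "?P \<subseteq> y" "y \<inter> {b} = {}"
    proof (rule prime_separation[of ?P "{b}"])
      show "?P \<noteq> {}" using aP by blast
      show "\<not> u \<sqsubseteq> v" if "u \<in> ?P" "v \<in> {b}" for u v
        using nle[OF that(1)] that(2) by simp
    qed (use meet ab join_idem that in \<open>auto simp only: singleton_iff\<close>)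
    then show False using * aP sub by blast
  qed
qed

text \<open>Prime filters separate elements: this is \<open>prime_separation\<close> for singletons.
  Inequalities between terms thereby reduce to conditions on the poset of prime filters.\<close>

lemma prime_le_iff:
  assumes "a \<in> carrier L" "b \<in> carrier L"
  shows "a \<sqsubseteq> b \<longleftrightarrow> (\<forall>x. prime_filter L x \<longrightarrow> a \<in> x \<longrightarrow> b \<in> x)"
proof
  assume *: "\<forall>x. prime_filter L x \<longrightarrow> a \<in> x \<longrightarrow> b \<in> x"
  show "a \<sqsubseteq> b"
  proof (rule ccontr)
    assume no: "\<not> a \<sqsubseteq> b"
    then obtain x where "prime_filter L x" "{a} \<subseteq> x" "x \<inter> {b} = {}"
      using prime_separation[of "{a}" "{b}"] assms meet_idem join_idem by auto
    then show False using * by auto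
  qed
qed (use assms prime_filterD(2) in blast)

section \<open>Values equal to top, evaluation of formulas and soundness\<close>

lemma eq_top_iff: "a \<in> carrier L \<Longrightarrow> a = \<top> \<longleftrightarrow> \<top> \<sqsubseteq> a"
  by (metis le_antisym le_refl top_closed top_higher)

lemma himp_eq_top_iff:
  assumes "a \<in> carrier L" "b \<in> carrier L"
  shows "a \<rightarrow>\<^sub>H b = \<top> \<longleftrightarrow> a \<sqsubseteq> b"
proof -
  have "\<top> \<sqinter> a = a"
    using assms by (auto intro!: meet_eqI)
  then show ?thesis using assms by (simp add: eq_top_iff le_himp_iff)
qed

lemma meet_eq_top_iff:
  assumes "a \<in> carrier L" "b \<in> carrier L"
  shows "a \<sqinter> b = \<top> \<longleftrightarrow> a = \<top> \<and> b = \<top>"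
  using assms by (simp add: eq_top_iff le_meet_iff)

lemma ev_closed:
  "\<lbrakk>v \<in> {..<n} \<rightarrow> carrier L; \<chi> \<in> formulas n\<rbrakk> \<Longrightarrow> ev L v \<chi> \<in> carrier L"
  by (induction \<chi>) auto

text \<open>Each axiom becomes an inequality and is checked on prime filters, where it is a
  propositional triviality. All variables need values in the carrier because modus ponens may
  eliminate a formula with variables foreign to the conclusion.\<close>

lemma ipc_sound:
  assumes "ipc \<chi>" "range v \<subseteq> carrier L"
  shows "ev L v \<chi> = \<top>"
proof -
  have cl: "ev L v \<theta> \<in> carrier L" for \<theta>
    using assms(2) by (induction \<theta>) auto
  show ?thesis
    using assms(1)
  proof induction
    case (MP \<phi> \<psi>)
    then show ?case
      by (simp add: cl himp_eq_top_iff) (metis cl eq_top_iff)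
  qed (auto simp: cl himp_eq_top_iff prime_le_iff prime_filter_himp prime_filter_meet
      prime_filter_join prime_filter_bottom)
qed

lemma ev_mono:
  assumes "ipc (Imp \<phi> \<psi>)" "\<phi> \<in> formulas n" "\<psi> \<in> formulas n" "v \<in> {..<n} \<rightarrow> carrier L"
  shows "ev L v \<phi> \<sqsubseteq> ev L v \<psi>"
proof -
  \<comment> \<open>Variables from \<open>n\<close> on do not occur in the two formulas; they
    receive the default value top so that \<open>ipc_sound\<close> applies.\<close>
  define w where "w i = (if i < n then v i else \<top>)" for i
  have eq: "ev L w \<theta> = ev L v \<theta>" if "\<theta> \<in> formulas n" for \<theta>
    using that by (induction \<theta>) (auto simp: w_def)
  have "range w \<subseteq> carrier L" using assms(4) by (auto simp: w_def)
  then have "ev L w (Imp \<phi> \<psi>) = \<top>" using assms(1) ipc_sound by blast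
  then show ?thesis
    using assms by (simp add: eq himp_eq_top_iff ev_closed)
qed

lemma ev_conj_list_eq_top_iff:
  assumes "v \<in> {..<n} \<rightarrow> carrier L" "set \<phi>s \<subseteq> formulas n"
  shows "ev L v (foldr And \<phi>s Top) = \<top> \<longleftrightarrow> (\<forall>\<chi>\<in>set \<phi>s. ev L v \<chi> = \<top>)"
  using assms(2)
proof (induction \<phi>s)
  case (Cons \<chi> \<phi>s)
  have "foldr And \<phi>s Top \<in> formulas n" using Cons.prems by (induction \<phi>s) auto
  then show ?case using Cons ev_closed[OF assms(1)] by (simp add: meet_eq_top_iff)
qed simp

text \<open>\<open>big_and\<close> chooses an enumeration of its argument by \<open>SOME\<close>,
  and finiteness guarantees that one exists. This is the reason for proving
  \<open>finite_balls\<close> below.\<close>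

lemma ev_big_and_eq_top_iff:
  assumes "v \<in> {..<n} \<rightarrow> carrier L" "\<Gamma> \<subseteq> formulas n" "finite \<Gamma>"
  shows "ev L v (big_and \<Gamma>) = \<top> \<longleftrightarrow> (\<forall>\<chi>\<in>\<Gamma>. ev L v \<chi> = \<top>)"
proof -
  have "set (SOME \<phi>s. distinct \<phi>s \<and> set \<phi>s = \<Gamma>) = \<Gamma>"
    using finite_distinct_list[OF assms(3)]
    by (metis (mono_tags, lifting) someI_ex)
  then show ?thesis
    using ev_conj_list_eq_top_iff[OF assms(1)] assms(2) by (simp add: big_and_def)
qed

end

subsection \<open>Prime filters of free Heyting algebras\<close>

text \<open>The abstract lattice operations of the free algebra act on classes as the connectives
  do. Top, bottom, join and implication in \<open>F(n)\<close> are later read off by applying this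
  to a compound formula.\<close>

lemma ev_free:
  assumes "\<chi> \<in> formulas n"
  shows "ev (free_heyting n) (\<lambda>i. cls (Var i)) \<chi> = cls \<chi>"
proof -
  interpret heyting_algebra "free_heyting n"
    by (rule heyting_algebra_free_heyting)
  show ?thesis
    using assms
  proof (induction \<chi>)
    case Bot
    then show ?case
      by (auto intro!: bottom_eq[symmetric] simp: free_carrier free_le_iff BotE)
  next
    case Top
    then show ?case
      by (auto intro!: top_eq[symmetric] simp: free_carrier free_le_iff ipc_Top)
  next
    case (And \<phi> \<psi>)
    then show ?case by (simp add: free_meet)
  next
    case (Or \<phi> \<psi>)
    then have "cls \<phi> \<squnion>\<^bsub>free_heyting n\<^esub> cls \<psi> = cls (Or \<phi> \<psi>)"
      by (intro join_eqI) (auto simp: free_carrier free_le_iff ipc_Or)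
    with Or show ?case by simp
  next
    case (Imp \<phi> \<psi>)
    then have "cls \<phi> \<rightarrow>\<^sub>H\<^bsub>free_heyting n\<^esub> cls \<psi> = cls (Imp \<phi> \<psi>)"
      by (intro himp_eqI) (auto simp: free_carrier free_le_iff free_meet ipc_Imp)
    with Imp show ?case by simp
  qed simp
qed

lemma Es_mono:
  assumes "x \<in> Es n" "cls \<phi> \<in> x" "ipc (Imp \<phi> \<psi>)" "\<psi> \<in> formulas n"
  shows "cls \<psi> \<in> x"
  using assms unfolding Es_def prime_filter_def by (auto simp: free_carrier free_le_iff)

lemma Es_And:
  assumes "x \<in> Es n" "\<phi> \<in> formulas n" "\<psi> \<in> formulas n"
  shows "cls (And \<phi> \<psi>) \<in> x \<longleftrightarrow> cls \<phi> \<in> x \<and> cls \<psi> \<in> x"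
  using heyting_algebra.prime_filter_meet[OF heyting_algebra_free_heyting, of n x "cls \<phi>" "cls \<psi>"]
    assms by (simp add: Es_def free_carrier free_meet)

lemma Es_Or:
  assumes "x \<in> Es n" "\<phi> \<in> formulas n" "\<psi> \<in> formulas n"
  shows "cls (Or \<phi> \<psi>) \<in> x \<longleftrightarrow> cls \<phi> \<in> x \<or> cls \<psi> \<in> x"
  using heyting_algebra.prime_filter_join[OF heyting_algebra_free_heyting, of n x "cls \<phi>" "cls \<psi>"]
    assms ev_free[of "Or \<phi> \<psi>" n] by (simp add: Es_def free_carrier ev_free)

lemma Es_Imp:
  assumes "x \<in> Es n" "\<phi> \<in> formulas n" "\<psi> \<in> formulas n"
  shows "cls (Imp \<phi> \<psi>) \<in> x \<longleftrightarrow> (\<forall>y\<in>Es n. x \<subseteq> y \<longrightarrow> cls \<phi> \<in> y \<longrightarrow> cls \<psi> \<in> y)"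
  using heyting_algebra.prime_filter_himp[OF heyting_algebra_free_heyting, of n x "cls \<phi>" "cls \<psi>"]
    assms ev_free[of "Imp \<phi> \<psi>" n] by (auto simp: Es_def free_carrier ev_free)

lemma Es_Top: "x \<in> Es n \<Longrightarrow> cls Top \<in> x"
  using heyting_algebra.prime_filter_top[OF heyting_algebra_free_heyting, of n x] ev_free[of Top n]
  by (simp add: Es_def)

lemma Es_Bot: "x \<in> Es n \<Longrightarrow> cls Bot \<notin> x"
  using heyting_algebra.prime_filter_bottom[OF heyting_algebra_free_heyting, of n x] ev_free[of Bot n]
  by (simp add: Es_def)

text \<open>Completeness for the canonical model on \<open>n\<close> variables.\<close>

lemma ipc_Imp_iff_Es:
  assumes "\<phi> \<in> formulas n" "\<psi> \<in> formulas n"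
  shows "ipc (Imp \<phi> \<psi>) \<longleftrightarrow> (\<forall>x\<in>Es n. cls \<phi> \<in> x \<longrightarrow> cls \<psi> \<in> x)"
  using heyting_algebra.prime_le_iff[OF heyting_algebra_free_heyting, of "cls \<phi>" n "cls \<psi>"] assms
  by (auto simp: Es_def free_carrier free_le_iff)


section \<open>Inverse images of prime filters under the homomorphism from \<open>F(n)\<close>
  induced by a tuple\<close>

definition pullback :: "nat \<Rightarrow> ('a, 'm) gorder_scheme \<Rightarrow> (nat \<Rightarrow> 'a) \<Rightarrow> 'a set \<Rightarrow> nat fm set set"
  where "pullback n L v x = {cls \<chi> |\<chi>. \<chi> \<in> formulas n \<and> ev L v \<chi> \<in> x}"

context heyting_algebra
begin

text \<open>Membership is independent of the representative: equivalent formulas have comparable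
  values by \<open>ev_mono\<close>, and \<open>x\<close> is upward closed.\<close>

lemma cls_in_pullback_iff:
  assumes "prime_filter L x" "v \<in> {..<n} \<rightarrow> carrier L" "\<chi> \<in> formulas n"
  shows "cls \<chi> \<in> pullback n L v x \<longleftrightarrow> ev L v \<chi> \<in> x"
proof
  assume "cls \<chi> \<in> pullback n L v x"
  then obtain \<theta> where "\<theta> \<in> formulas n" "ev L v \<theta> \<in> x" "ipc (Imp \<theta> \<chi>)"
    unfolding pullback_def by (auto simp: cls_eq_iff)
  then show "ev L v \<chi> \<in> x"
    using prime_filterD(2)[OF assms(1) _ ev_mono[OF _ _ assms(3,2)] ev_closed[OF assms(2,3)]] by blast
qed (use assms in \<open>auto simp: pullback_def\<close>)

lemma pullback_in_Es:
  assumes "prime_filter L x" "v \<in> {..<n} \<rightarrow> carrier L"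
  shows "pullback n L v x \<in> Es n"
proof -
  note mem = cls_in_pullback_iff[OF assms] and cl = ev_closed[OF assms(2)]
  have sub: "pullback n L v x \<subseteq> carrier (free_heyting n)"
    by (auto simp: pullback_def free_carrier)
  have "cls Top \<in> pullback n L v x" "cls Bot \<notin> pullback n L v x"
    using mem[of Top] mem[of Bot] prime_filter_top[OF assms(1)] prime_filter_bottom[OF assms(1)]
    by simp_all
  moreover have "cls Bot \<in> carrier (free_heyting n)" by (simp add: free_carrier)
  moreover have "\<psi>' \<in> pullback n L v x"
    if up: "\<phi>' \<in> pullback n L v x" "\<psi>' \<in> carrier (free_heyting n)" "\<phi>' \<sqsubseteq>\<^bsub>free_heyting n\<^esub> \<psi>'" for \<phi>' \<psi>'
  proof -
    obtain \<phi> \<psi> where "\<phi> \<in> formulas n" "\<phi>' = cls \<phi>" "\<psi> \<in> formulas n" "\<psi>' = cls \<psi>"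
      using up(1,2) sub unfolding free_carrier by blast
    with up ev_mono[of \<phi> \<psi> n v] assms show ?thesis
      using prime_filterD(2)[OF assms(1)] cl by (simp add: mem free_le_iff)
  qed
  moreover have "u \<sqinter>\<^bsub>free_heyting n\<^esub> w \<in> pullback n L v x"
    if uw: "u \<in> pullback n L v x" "w \<in> pullback n L v x" for u w
  proof -
    obtain \<phi> \<psi> where "\<phi> \<in> formulas n" "u = cls \<phi>" "\<psi> \<in> formulas n" "w = cls \<psi>"
      using uw sub unfolding free_carrier by blast
    with uw show ?thesis
      using assms(1) cl by (simp add: mem free_meet prime_filter_meet)
  qed
  moreover have "u \<in> pullback n L v x \<or> w \<in> pullback n L v x"
    if uw: "u \<squnion>\<^bsub>free_heyting n\<^esub> w \<in> pullback n L v x"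
      "u \<in> carrier (free_heyting n)" "w \<in> carrier (free_heyting n)" for u w
  proof -
    obtain \<phi> \<psi> where "\<phi> \<in> formulas n" "u = cls \<phi>" "\<psi> \<in> formulas n" "w = cls \<psi>"
      using uw(2,3) unfolding free_carrier by blast
    with uw ev_free[of "Or \<phi> \<psi>" n] show ?thesis
      using assms(1) cl by (simp add: mem ev_free prime_filter_join)
  qed
  ultimately show ?thesis
    using sub unfolding Es_def prime_filter_def by blast
qed

text \<open>The map on prime filters that is dual to a homomorphism out of \<open>F(p)\<close> lifts inclusions
  (it is a p-morphism).\<close>

lemma pullback_lift:
  assumes x: "prime_filter L x" and v: "v \<in> {..<n} \<rightarrow> carrier L"
    and z: "z \<in> Es n" "pullback n L v x \<subseteq> z"
  obtains y where "prime_filter L y" "x \<subseteq> y" "pullback n L v y = z"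
proof -
  note cl = ev_closed[OF v]
  \<comment> \<open>\<open>?P\<close> is a base of the filter generated by \<open>x\<close> and the
    values of the formulas in \<open>z\<close>; \<open>?Q\<close> consists of the values that
    \<open>y\<close> has to omit for its inverse image to be exactly \<open>z\<close>.\<close>
  let ?P = "{u \<sqinter> ev L v \<chi> |u \<chi>. u \<in> x \<and> \<chi> \<in> formulas n \<and> cls \<chi> \<in> z}"
  let ?Q = "{ev L v \<chi> |\<chi>. \<chi> \<in> formulas n \<and> cls \<chi> \<notin> z}"
  have xc: "u \<in> carrier L" if "u \<in> x" for u using prime_filterD(1)[OF x that] .
  obtain y where y: "prime_filter L y" "?P \<subseteq> y" "y \<inter> ?Q = {}"
  proof (rule prime_separation[of ?P ?Q])
    show "?P \<subseteq> carrier L" "?Q \<subseteq> carrier L" using xc cl by auto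
    show "?P \<noteq> {}" using prime_filter_top[OF x] Es_Top[OF z(1)] formulas_simps(2) by blast
    show "?Q \<noteq> {}" using Es_Bot[OF z(1)] formulas_simps(1) by blast
    show "a \<sqinter> b \<in> ?P" if ab: "a \<in> ?P" "b \<in> ?P" for a b
    proof -
      obtain u \<chi> where 1: "a = u \<sqinter> ev L v \<chi>" "u \<in> x" "\<chi> \<in> formulas n" "cls \<chi> \<in> z"
        using ab(1) by blast
      obtain w \<theta> where 2: "b = w \<sqinter> ev L v \<theta>" "w \<in> x" "\<theta> \<in> formulas n" "cls \<theta> \<in> z"
        using ab(2) by blast
      have "a \<sqinter> b = (u \<sqinter> w) \<sqinter> ev L v (And \<chi> \<theta>)"
        using 1 2 xc cl by (intro meet_eqI) (auto simp: le_meet_iff)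
      moreover have "u \<sqinter> w \<in> x" using 1 2 xc x by (simp add: prime_filter_meet)
      moreover have "And \<chi> \<theta> \<in> formulas n" "cls (And \<chi> \<theta>) \<in> z" using 1 2 z(1) by (auto simp: Es_And)
      ultimately show ?thesis by blast
    qed
    show "a \<squnion> b \<in> ?Q" if ab: "a \<in> ?Q" "b \<in> ?Q" for a b
    proof -
      obtain \<chi> \<theta> where "a = ev L v \<chi>" "\<chi> \<in> formulas n" "cls \<chi> \<notin> z"
        "b = ev L v \<theta>" "\<theta> \<in> formulas n" "cls \<theta> \<notin> z"
        using ab by blast
      then have "a \<squnion> b = ev L v (Or \<chi> \<theta>)" "Or \<chi> \<theta> \<in> formulas n" "cls (Or \<chi> \<theta>) \<notin> z"
        using z(1) by (auto simp: Es_Or)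
      then show ?thesis by blast
    qed
    show "\<not> a \<sqsubseteq> b" if ab: "a \<in> ?P" "b \<in> ?Q" for a b
    proof
      assume le: "a \<sqsubseteq> b"
      obtain u \<chi> where 1: "a = u \<sqinter> ev L v \<chi>" "u \<in> x" "\<chi> \<in> formulas n" "cls \<chi> \<in> z"
        using ab(1) by blast
      obtain \<theta> where 2: "b = ev L v \<theta>" "\<theta> \<in> formulas n" "cls \<theta> \<notin> z"
        using ab(2) by blast
      \<comment> \<open>Residuation moves \<open>\<chi>\<close> to the right, so that the
        implication lies in \<open>x\<close> and therefore in \<open>z\<close>, where modus ponens
        contradicts the choice of \<open>\<theta>\<close>.\<close>
      have "u \<sqsubseteq> ev L v (Imp \<chi> \<theta>)"
        using le 1 2 xc cl by (simp add: le_himp_iff)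
      then have "ev L v (Imp \<chi> \<theta>) \<in> x"
        using prime_filterD(2)[OF x 1(2)] cl 1 2 by simp
      then have "cls (Imp \<chi> \<theta>) \<in> z"
        using cls_in_pullback_iff[OF x v, of "Imp \<chi> \<theta>"] 1 2 z(2) by auto
      then show False using Es_Imp[OF z(1)] 1 2 z(1) by blast
    qed
  qed (rule that)
  have "x \<subseteq> y"
  proof
    fix u assume u: "u \<in> x"
    then have "u \<sqinter> ev L v Top \<in> ?P" using Es_Top[OF z(1)] formulas_simps(2) by blast
    then have "u \<sqinter> ev L v Top \<in> y" using y(2) by blast
    then show "u \<in> y" using u xc y(1) by (simp add: prime_filter_meet)
  qed
  moreover have "ev L v \<chi> \<in> y \<longleftrightarrow> cls \<chi> \<in> z" if \<chi>: "\<chi> \<in> formulas n" for \<chi>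
  proof
    assume "ev L v \<chi> \<in> y" then show "cls \<chi> \<in> z" using y(3) \<chi> by blast
  next
    assume "cls \<chi> \<in> z"
    then have "\<top> \<sqinter> ev L v \<chi> \<in> ?P" using prime_filter_top[OF x] \<chi> by blast
    then have "\<top> \<sqinter> ev L v \<chi> \<in> y" using y(2) by blast
    then show "ev L v \<chi> \<in> y" using cl[OF \<chi>] y(1) by (simp add: prime_filter_meet)
  qed
  moreover have "z \<subseteq> cls ` formulas n"
    using z(1) unfolding Es_def prime_filter_def free_carrier by blast
  ultimately have "x \<subseteq> y" "pullback n L v y = z"
    unfolding pullback_def by blast+
  then show thesis using y(1) that by blast
qed

end

section \<open>Restriction of points from \<open>F(p, q)\<close> to \<open>F(p)\<close>\<close>

lemma formulas_Suc: "\<chi> \<in> formulas l \<Longrightarrow> \<chi> \<in> formulas (Suc l)"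
  by (auto simp: formulas_def)

text \<open>Restriction is the inverse image under the inclusion of \<open>F(p)\<close> in
  \<open>F(p, q)\<close>, so the general facts about pullbacks, in particular the lifting of
  inclusions, apply to it.\<close>

lemma restriction_eq_pullback:
  "x \<inter> carrier (free_heyting l) = pullback l (free_heyting (Suc l)) (\<lambda>i. cls (Var i)) x"
  by (auto simp: pullback_def free_carrier ev_free formulas_Suc)

lemma free_vars_closed_Suc: "(\<lambda>i. cls (Var i)) \<in> {..<l} \<rightarrow> carrier (free_heyting (Suc l))"
  by (auto simp: free_carrier)

lemma restriction_in_Es: "x \<in> Es (Suc l) \<Longrightarrow> x \<inter> carrier (free_heyting l) \<in> Es l"
  unfolding restriction_eq_pullback
  using heyting_algebra.pullback_in_Es[OF heyting_algebra_free_heyting _ free_vars_closed_Suc]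
  by (simp add: Es_def)

lemma restriction_lift:
  assumes "x \<in> Es (Suc l)" "z \<in> Es l" "x \<inter> carrier (free_heyting l) \<subseteq> z"
  obtains y where "y \<in> Es (Suc l)" "x \<subseteq> y" "y \<inter> carrier (free_heyting l) = z"
  using heyting_algebra.pullback_lift[OF heyting_algebra_free_heyting _ free_vars_closed_Suc, of l x z]
    assms that unfolding restriction_eq_pullback Es_def mem_Collect_eq by blast

subsection \<open>Finiteness of the set of balls\<close>

text \<open>A complete invariant for \<open>sim n m\<close>: two points are related iff their low
  theories coincide. Finiteness of the set of balls thus becomes finiteness of an image.\<close>

definition low_theory :: "nat \<Rightarrow> nat \<Rightarrow> nat fm set set \<Rightarrow> nat fm set"
  where "low_theory n m x = {\<chi> \<in> formulas n. degree \<chi> \<le> m \<and> cls \<chi> \<in> x}"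

text \<open>A point is determined, up to degree \<open>m\<close>, by the variables and the implications
  it contains, and an implication only matters up to equivalence of its two sides.\<close>

lemma low_theory_eqI:
  assumes x: "x \<in> Es n" and y: "y \<in> Es n"
    and var: "\<And>i. i < n \<Longrightarrow> cls (Var i) \<in> x \<longleftrightarrow> cls (Var i) \<in> y"
    and imp: "\<And>\<phi> \<psi>. \<phi> \<in> formulas n \<Longrightarrow> \<psi> \<in> formulas n \<Longrightarrow> degree (Imp \<phi> \<psi>) \<le> m \<Longrightarrow>
       cls (Imp \<phi> \<psi>) \<in> x \<longleftrightarrow> cls (Imp \<phi> \<psi>) \<in> y"
  shows "low_theory n m x = low_theory n m y"
proof -
  have "cls \<chi> \<in> x \<longleftrightarrow> cls \<chi> \<in> y" if "\<chi> \<in> formulas n" "degree \<chi> \<le> m" for \<chi>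
    using that
  proof (induction \<chi>)
    case (Imp \<phi> \<psi>)
    then show ?case using imp by auto
  qed (auto simp: var Es_Bot[OF x] Es_Bot[OF y] Es_Top[OF x] Es_Top[OF y] Es_And[OF x] Es_And[OF y]
      Es_Or[OF x] Es_Or[OF y])
  then show ?thesis by (auto simp: low_theory_def)
qed

lemma finite_image_if_factors:
  assumes "finite (f ` S)" "\<And>x y. x \<in> S \<Longrightarrow> y \<in> S \<Longrightarrow> f x = f y \<Longrightarrow> g x = g y"
  shows "finite (g ` S)"
proof -
  have "g x = g (inv_into S f (f x))" if "x \<in> S" for x
    by (rule assms(2)) (use that in \<open>auto intro: inv_into_into simp: f_inv_into_f\<close>)
  then have "g ` S \<subseteq> (\<lambda>u. g (inv_into S f u)) ` f ` S"
    unfolding image_image by blast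
  then show ?thesis using assms(1) by (rule finite_surj[rotated])
qed

text \<open>By completeness a class is determined by the points that contain it, hence, in degree at
  most \<open>m\<close>, by the set of those low theories that contain the formula. There are
  finitely many such sets.\<close>

lemma finite_classes_of_degree:
  assumes "finite (low_theory n m ` Es n)"
  shows "finite (cls ` {\<chi> \<in> formulas n. degree \<chi> \<le> m})"
proof (rule finite_image_if_factors)
  let ?t = "\<lambda>\<chi>. {T \<in> low_theory n m ` Es n. \<chi> \<in> T}"
  show "finite (?t ` {\<chi> \<in> formulas n. degree \<chi> \<le> m})"
    by (rule finite_subset[of _ "Pow (low_theory n m ` Es n)"]) (use assms in auto)
  fix \<phi> \<psi>
  assume \<phi>: "\<phi> \<in> {\<chi> \<in> formulas n. degree \<chi> \<le> m}" and \<psi>: "\<psi> \<in> {\<chi> \<in> formulas n. degree \<chi> \<le> m}"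
    and eq: "?t \<phi> = ?t \<psi>"
  have "cls \<phi> \<in> x \<longleftrightarrow> cls \<psi> \<in> x" if "x \<in> Es n" for x
  proof -
    have "low_theory n m x \<in> ?t \<phi> \<longleftrightarrow> low_theory n m x \<in> ?t \<psi>" using eq by blast
    then show ?thesis using \<phi> \<psi> that by (auto simp: low_theory_def)
  qed
  then show "cls \<phi> = cls \<psi>"
    using \<phi> \<psi> by (auto simp: cls_eq_iff ipc_Imp_iff_Es)
qed

lemma cls_Imp_cong:
  assumes "cls \<phi> = cls \<phi>'" "cls \<psi> = cls \<psi>'"
  shows "cls (Imp \<phi> \<psi>) = cls (Imp \<phi>' \<psi>')"
proof -
  have mono: "ipc (Imp (Imp \<alpha> \<beta>) (Imp \<alpha>' \<beta>'))" if "ipc (Imp \<alpha>' \<alpha>)" "ipc (Imp \<beta> \<beta>')"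
    for \<alpha> \<beta> \<alpha>' \<beta>' :: "'a fm"
  proof -
    have "ipc (Imp (And (Imp \<alpha> \<beta>) \<alpha>') (And (Imp \<alpha> \<beta>) \<alpha>))"
      using that(1) by (meson AndE1 AndE2 ipc_And ipc_trans)
    moreover have "ipc (Imp (And (Imp \<alpha> \<beta>) \<alpha>) \<beta>)"
      using ipc_Imp ipc_refl by blast
    ultimately show ?thesis
      using that(2) ipc_trans ipc_Imp by blast
  qed
  show ?thesis using assms mono by (simp add: cls_eq_iff)
qed

text \<open>Finitely many theories of degree \<open>m\<close> leave finitely many classes of
  formulas of degree at most \<open>m\<close>. A theory of degree \<open>Suc m\<close> is then
  determined by a set of variables and a set of pairs of such classes, the two sides of its
  implications.\<close>

lemma finite_low_theories: "finite (low_theory n m ` Es n)"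
proof (induction m)
  case 0
  show ?case
  proof (rule finite_image_if_factors)
    show "finite ((\<lambda>x. {i \<in> {..<n}. cls (Var i) \<in> x}) ` Es n)"
      by (rule finite_subset[of _ "Pow {..<n}"]) auto
    show "low_theory n 0 x = low_theory n 0 y" if "x \<in> Es n" "y \<in> Es n"
      "{i \<in> {..<n}. cls (Var i) \<in> x} = {i \<in> {..<n}. cls (Var i) \<in> y}" for x y
      by (rule low_theory_eqI) (use that in auto)
  qed
next
  case (Suc m)
  let ?D = "{\<chi> \<in> formulas n. degree \<chi> \<le> m}"
  let ?C = "cls ` ?D"
  let ?f = "\<lambda>x. {i \<in> {..<n}. cls (Var i) \<in> x}"
  let ?g = "\<lambda>x. {(cls \<phi>, cls \<psi>) |\<phi> \<psi>. \<phi> \<in> ?D \<and> \<psi> \<in> ?D \<and> cls (Imp \<phi> \<psi>) \<in> x}"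
  have "finite ?C" by (rule finite_classes_of_degree[OF Suc.IH])
  show ?case
  proof (rule finite_image_if_factors)
    show "finite ((\<lambda>x. (?f x, ?g x)) ` Es n)"
    proof (rule finite_subset)
      show "(\<lambda>x. (?f x, ?g x)) ` Es n \<subseteq> Pow {..<n} \<times> Pow (?C \<times> ?C)" by blast
      show "finite (Pow {..<n} \<times> Pow (?C \<times> ?C))" using \<open>finite ?C\<close> by simp
    qed
    fix x y assume xy: "x \<in> Es n" "y \<in> Es n" and eq: "(?f x, ?g x) = (?f y, ?g y)"
    have eqf: "?f x = ?f y" and eqg: "?g x = ?g y" using eq by (simp_all only: prod.inject)
    show "low_theory n (Suc m) x = low_theory n (Suc m) y"
    proof (rule low_theory_eqI[OF xy])
      show "cls (Var i) \<in> x \<longleftrightarrow> cls (Var i) \<in> y" if "i < n" for i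
        using eqf that by blast
      fix \<phi> \<psi> assume f: "\<phi> \<in> formulas n" "\<psi> \<in> formulas n" "degree (Imp \<phi> \<psi>) \<le> Suc m"
      then have D: "\<phi> \<in> ?D" "\<psi> \<in> ?D" by auto
      \<comment> \<open>The pair may have entered \<open>?g z\<close> through other representatives;
        \<open>cls_Imp_cong\<close> makes this harmless.\<close>
      have g: "(cls \<phi>, cls \<psi>) \<in> ?g z \<longleftrightarrow> cls (Imp \<phi> \<psi>) \<in> z" for z
      proof
        assume "(cls \<phi>, cls \<psi>) \<in> ?g z"
        then obtain \<phi>' \<psi>' where "cls \<phi> = cls \<phi>'" "cls \<psi> = cls \<psi>'" "cls (Imp \<phi>' \<psi>') \<in> z"
          unfolding mem_Collect_eq prod.inject by blast
        then show "cls (Imp \<phi> \<psi>) \<in> z" using cls_Imp_cong[of \<phi> \<phi>' \<psi> \<psi>'] by simp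
      qed (use D in blast)
      have "(cls \<phi>, cls \<psi>) \<in> ?g x \<longleftrightarrow> (cls \<phi>, cls \<psi>) \<in> ?g y" by (simp only: eqg)
      then show "cls (Imp \<phi> \<psi>) \<in> x \<longleftrightarrow> cls (Imp \<phi> \<psi>) \<in> y" by (simp only: g)
    qed
  qed
qed

lemma finite_balls: "finite (balls n m)"
  unfolding balls_eq_sim_classes
proof (rule finite_image_if_factors[OF finite_low_theories])
  show "{z \<in> Es n. sim n m x z} = {z \<in> Es n. sim n m y z}" if "low_theory n m x = low_theory n m y" for x y
    using that unfolding low_theory_def sim_def by (simp add: set_eq_iff) blast
qed

subsection \<open>The Heyting algebra of a Kripke model\<close>

text \<open>Kripke forcing on the suborder \<open>W\<close>. The clause for variables intersects
  with \<open>W\<close> because the valuation \<open>val\<close> used below is not confined to the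
  worlds.\<close>

primrec upsem :: "'w::order set \<Rightarrow> ('v \<Rightarrow> 'w set) \<Rightarrow> 'v fm \<Rightarrow> 'w set" where
  "upsem W V (Var i) = W \<inter> V i"
| "upsem W V Bot = {}"
| "upsem W V Top = W"
| "upsem W V (And \<phi> \<psi>) = upsem W V \<phi> \<inter> upsem W V \<psi>"
| "upsem W V (Or \<phi> \<psi>) = upsem W V \<phi> \<union> upsem W V \<psi>"
| "upsem W V (Imp \<phi> \<psi>) =
    {w \<in> W. \<forall>w'\<in>W. w \<le> w' \<longrightarrow> w' \<in> upsem W V \<phi> \<longrightarrow> w' \<in> upsem W V \<psi>}"

text \<open>The elements are classes of formulas rather than sets of worlds: an extension of \<open>A\<close> has
  to be realised on sets of formulas with variables in \<open>A\<close> and one additional variable.\<close>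

definition kcls :: "'w::order set \<Rightarrow> ('v \<Rightarrow> 'w set) \<Rightarrow> 'v fm \<Rightarrow> 'v fm set"
  where "kcls W V \<phi> = {\<psi>. upsem W V \<psi> = upsem W V \<phi>}"

text \<open>For a hereditary valuation this is, up to isomorphism, the Heyting algebra of those
  upsets of \<open>W\<close> that are definable by formulas over \<open>V\<close>.\<close>

definition kripke_algebra :: "'w::order set \<Rightarrow> ('v \<Rightarrow> 'w set) \<Rightarrow> 'v fm set gorder"
  where "kripke_algebra W V =
    \<lparr>carrier = range (kcls W V), eq = (=),
     le = (\<lambda>X Y. \<exists>\<phi>\<in>X. \<exists>\<psi>\<in>Y. upsem W V \<phi> \<subseteq> upsem W V \<psi>)\<rparr>"

locale kripke_model =
  fixes W :: "'w::order set" and V :: "'v \<Rightarrow> 'w set"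
  assumes hereditary: "w \<in> V i \<Longrightarrow> w \<le> w' \<Longrightarrow> w' \<in> W \<Longrightarrow> w' \<in> V i"
begin

lemma upsem_subset: "upsem W V \<phi> \<subseteq> W"
  by (induction \<phi>) auto

lemma upsem_up: "w \<in> upsem W V \<phi> \<Longrightarrow> w \<le> w' \<Longrightarrow> w' \<in> W \<Longrightarrow> w' \<in> upsem W V \<phi>"
proof (induction \<phi>)
  case (Imp \<phi> \<psi>)
  then show ?case using order_trans by (simp (no_asm_use)) blast
qed (auto intro: hereditary)

lemma kcls_eq_iff: "kcls W V \<phi> = kcls W V \<psi> \<longleftrightarrow> upsem W V \<phi> = upsem W V \<psi>"
  unfolding kcls_def by blast

lemma kripke_le_iff:
  "kcls W V \<phi> \<sqsubseteq>\<^bsub>kripke_algebra W V\<^esub> kcls W V \<psi> \<longleftrightarrow> upsem W V \<phi> \<subseteq> upsem W V \<psi>"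
  by (auto simp: kripke_algebra_def kcls_def)

lemma kripke_carrier: "carrier (kripke_algebra W V) = range (kcls W V)"
  by (simp add: kripke_algebra_def)

lemma kripke_eq: "(.=\<^bsub>kripke_algebra W V\<^esub>) = (=)"
  by (simp add: kripke_algebra_def)

lemma upsem_subset_Imp:
  "upsem W V \<chi> \<subseteq> upsem W V (Imp \<phi> \<psi>) \<longleftrightarrow> upsem W V \<chi> \<inter> upsem W V \<phi> \<subseteq> upsem W V \<psi>"
proof
  assume *: "upsem W V \<chi> \<subseteq> upsem W V (Imp \<phi> \<psi>)"
  show "upsem W V \<chi> \<inter> upsem W V \<phi> \<subseteq> upsem W V \<psi>"
  proof
    fix w assume w: "w \<in> upsem W V \<chi> \<inter> upsem W V \<phi>"
    then have "w \<in> upsem W V (Imp \<phi> \<psi>)" using * by blast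
    then show "w \<in> upsem W V \<psi>" using w by auto
  qed
next
  assume "upsem W V \<chi> \<inter> upsem W V \<phi> \<subseteq> upsem W V \<psi>"
  then show "upsem W V \<chi> \<subseteq> upsem W V (Imp \<phi> \<psi>)"
    using upsem_subset[of \<chi>] upsem_up[of _ \<chi>] by auto
qed

lemma bounded_lattice_kripke: "bounded_lattice (kripke_algebra W V)"
proof -
  interpret partial_order "kripke_algebra W V"
    by unfold_locales
      (auto simp: kripke_eq kripke_carrier kripke_le_iff, auto simp: kcls_def)
  show ?thesis
  proof
    show "\<exists>x. least (kripke_algebra W V) x (carrier (kripke_algebra W V))"
      by (rule exI[of _ "kcls W V Bot"]) (auto simp: least_def kripke_carrier kripke_le_iff)
    show "\<exists>x. greatest (kripke_algebra W V) x (carrier (kripke_algebra W V))"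
      using upsem_subset
      by (intro exI[of _ "kcls W V Top"]) (auto simp: greatest_def kripke_carrier kripke_le_iff)
    fix x y assume "x \<in> carrier (kripke_algebra W V)" "y \<in> carrier (kripke_algebra W V)"
    then obtain \<phi> \<psi> where xy: "x = kcls W V \<phi>" "y = kcls W V \<psi>"
      by (auto simp: kripke_carrier)
    show "\<exists>s. is_lub (kripke_algebra W V) s {x, y}"
      by (intro exI[of _ "kcls W V (Or \<phi> \<psi>)"])
        (auto simp: xy least_def Upper_def kripke_carrier kripke_le_iff)
    show "\<exists>s. is_glb (kripke_algebra W V) s {x, y}"
      by (intro exI[of _ "kcls W V (And \<phi> \<psi>)"])
        (auto simp: xy greatest_def Lower_def kripke_carrier kripke_le_iff)
  qed
qed

lemma kripke_meet:
  "kcls W V \<phi> \<sqinter>\<^bsub>kripke_algebra W V\<^esub> kcls W V \<psi> = kcls W V (And \<phi> \<psi>)"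
proof -
  interpret bounded_lattice "kripke_algebra W V" by (rule bounded_lattice_kripke)
  have c: "kcls W V \<chi> \<in> carrier (kripke_algebra W V)" for \<chi>
    by (simp add: kripke_carrier)
  show ?thesis
  proof (rule le_antisym)
    let ?m = "kcls W V \<phi> \<sqinter>\<^bsub>kripke_algebra W V\<^esub> kcls W V \<psi>"
    have "?m \<in> carrier (kripke_algebra W V)" by (simp add: c)
    then obtain \<chi> where "?m = kcls W V \<chi>" by (auto simp: kripke_carrier)
    moreover have "?m \<sqsubseteq>\<^bsub>kripke_algebra W V\<^esub> kcls W V \<phi>" "?m \<sqsubseteq>\<^bsub>kripke_algebra W V\<^esub> kcls W V \<psi>"
      by (simp_all add: c meet_left meet_right)
    ultimately show "?m \<sqsubseteq>\<^bsub>kripke_algebra W V\<^esub> kcls W V (And \<phi> \<psi>)"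
      by (simp add: kripke_le_iff)
    show "kcls W V (And \<phi> \<psi>) \<sqsubseteq>\<^bsub>kripke_algebra W V\<^esub> ?m"
      by (rule meet_le) (simp_all add: c kripke_le_iff)
  qed (simp_all add: c)
qed

lemma heyting_algebra_kripke: "heyting_algebra (kripke_algebra W V)"
proof -
  interpret bounded_lattice "kripke_algebra W V" by (rule bounded_lattice_kripke)
  show ?thesis
  proof
    fix a b assume "a \<in> carrier (kripke_algebra W V)" "b \<in> carrier (kripke_algebra W V)"
    then obtain \<phi> \<psi> where ab: "a = kcls W V \<phi>" "b = kcls W V \<psi>"
      by (auto simp: kripke_carrier)
    have "greatest (kripke_algebra W V) (kcls W V (Imp \<phi> \<psi>))
      {x \<in> carrier (kripke_algebra W V). x \<sqinter>\<^bsub>kripke_algebra W V\<^esub> a \<sqsubseteq>\<^bsub>kripke_algebra W V\<^esub> b}"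
      using upsem_subset_Imp[of "Imp \<phi> \<psi>" \<phi> \<psi>]
      by (auto simp: greatest_def ab kripke_carrier kripke_meet kripke_le_iff upsem_subset_Imp
          simp del: upsem.simps(6))
    then show "\<exists>c. greatest (kripke_algebra W V) c
      {x \<in> carrier (kripke_algebra W V). x \<sqinter>\<^bsub>kripke_algebra W V\<^esub> a \<sqsubseteq>\<^bsub>kripke_algebra W V\<^esub> b}" ..
  qed
qed

lemma kripke_bottom: "\<bottom>\<^bsub>kripke_algebra W V\<^esub> = kcls W V Bot"
  and kripke_top: "\<top>\<^bsub>kripke_algebra W V\<^esub> = kcls W V Top"
  and kripke_join: "kcls W V \<phi> \<squnion>\<^bsub>kripke_algebra W V\<^esub> kcls W V \<psi> = kcls W V (Or \<phi> \<psi>)"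
  and kripke_himp: "kcls W V \<phi> \<rightarrow>\<^sub>H\<^bsub>kripke_algebra W V\<^esub> kcls W V \<psi> = kcls W V (Imp \<phi> \<psi>)"
proof -
  interpret heyting_algebra "kripke_algebra W V" by (rule heyting_algebra_kripke)
  show "\<bottom>\<^bsub>kripke_algebra W V\<^esub> = kcls W V Bot"
    by (rule bottom_eq[symmetric]) (auto simp: kripke_carrier kripke_le_iff)
  show "\<top>\<^bsub>kripke_algebra W V\<^esub> = kcls W V Top"
    using upsem_subset by (intro top_eq[symmetric]) (auto simp: kripke_carrier kripke_le_iff)
  show "kcls W V \<phi> \<squnion>\<^bsub>kripke_algebra W V\<^esub> kcls W V \<psi> = kcls W V (Or \<phi> \<psi>)"
    by (rule join_eqI) (auto simp: kripke_carrier kripke_le_iff)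
  show "kcls W V \<phi> \<rightarrow>\<^sub>H\<^bsub>kripke_algebra W V\<^esub> kcls W V \<psi> = kcls W V (Imp \<phi> \<psi>)"
    by (rule himp_eqI)
      (auto simp: kripke_carrier kripke_meet kripke_le_iff upsem_subset_Imp simp del: upsem.simps(6))
qed

text \<open>All operations act on representatives, so evaluation at classes of variables amounts to
  renaming. The tuple and the solution will both be classes of variables, which turns the system
  into a question of forcing.\<close>

lemma ev_kripke:
  "ev (kripke_algebra W V) (\<lambda>i. kcls W V (Var (g i))) \<chi> = kcls W V (map_fm g \<chi>)"
  by (induction \<chi>) (simp_all add: kripke_bottom kripke_top kripke_meet kripke_join kripke_himp)

lemma kcls_eq_top_iff: "kcls W V \<chi> = \<top>\<^bsub>kripke_algebra W V\<^esub> \<longleftrightarrow> W \<subseteq> upsem W V \<chi>"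
  using upsem_subset[of \<chi>] by (auto simp: kripke_top kcls_eq_iff)

end

subsection \<open>The extension attached to a tuple and an equation\<close>

locale tuple_equation = heyting_algebra A for A (structure) +
  fixes l :: nat and a :: "nat \<Rightarrow> 'a" and t :: "nat fm"
  assumes tuple_closed: "a \<in> {..<l} \<rightarrow> carrier A"
begin

definition worlds :: "('a set \<times> nat fm set set) set"
  where "worlds = {(x, y). prime_filter A x \<and> y \<in> Es (Suc l) \<and> cls t \<in> y \<and>
     y \<inter> carrier (free_heyting l) = pullback l A a x}"

text \<open>\<open>None\<close> names the unknown \<open>q\<close> and is read off the second
  component; \<open>Some c\<close> names the element \<open>c\<close> of \<open>A\<close> and is
  read off the first.\<close>

primrec val :: "'a option \<Rightarrow> ('a set \<times> nat fm set set) set" where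
  "val None = {w. cls (Var l) \<in> snd w}"
| "val (Some c) = {w. c \<in> fst w}"

sublocale model: kripke_model worlds val
proof
  show "w' \<in> val i" if "w \<in> val i" "w \<le> w'" for w w' i
    using that by (cases i) (auto simp: less_eq_prod_def)
qed

abbreviation "B \<equiv> kripke_algebra worlds val"

definition emb :: "'a \<Rightarrow> 'a option fm set"
  where "emb c = kcls worlds val (Var (Some c))"

text \<open>The pullback of \<open>x'\<close> contains the restriction of \<open>y\<close>, so
  \<open>restriction_lift\<close> supplies \<open>y'\<close>; it contains \<open>t\<close> because
  \<open>y\<close> does.\<close>

lemma world_lift_fst:
  assumes "(x, y) \<in> worlds" "prime_filter A x'" "x \<subseteq> x'"
  obtains y' where "(x', y') \<in> worlds" "y \<subseteq> y'"
proof -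
  have w: "y \<in> Es (Suc l)" "cls t \<in> y" "y \<inter> carrier (free_heyting l) = pullback l A a x"
    using assms(1) by (auto simp: worlds_def)
  have "pullback l A a x \<subseteq> pullback l A a x'"
    using assms(3) by (auto simp: pullback_def)
  then obtain y' where "y' \<in> Es (Suc l)" "y \<subseteq> y'" "y' \<inter> carrier (free_heyting l) = pullback l A a x'"
    using restriction_lift[OF w(1) pullback_in_Es[OF assms(2) tuple_closed]] w(3) by auto
  then show thesis using that w assms(2) by (auto simp: worlds_def)
qed

text \<open>The mirror image: \<open>pullback_lift\<close> supplies \<open>x'\<close> over the
  restriction of \<open>y'\<close>.\<close>

lemma world_lift_snd:
  assumes "(x, y) \<in> worlds" "y' \<in> Es (Suc l)" "y \<subseteq> y'"
  obtains x' where "(x', y') \<in> worlds" "x \<subseteq> x'"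
proof -
  have w: "prime_filter A x" "cls t \<in> y" "y \<inter> carrier (free_heyting l) = pullback l A a x"
    using assms(1) by (auto simp: worlds_def)
  have "pullback l A a x \<subseteq> y' \<inter> carrier (free_heyting l)"
    using assms(3) w(3) by blast
  then obtain x' where "prime_filter A x'" "x \<subseteq> x'" "pullback l A a x' = y' \<inter> carrier (free_heyting l)"
    using pullback_lift[OF w(1) tuple_closed restriction_in_Es[OF assms(2)]] by metis
  moreover have "cls t \<in> y'" using w(2) assms(3) by blast
  ultimately show thesis using that[of x'] assms(2) by (simp add: worlds_def)
qed

text \<open>Forcing quantifies over larger worlds, \<open>prime_filter_himp\<close> over larger
  prime filters of \<open>A\<close>. By \<open>world_lift_fst\<close> every larger prime filter is
  the first component of a larger world, so the two agree.\<close>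

lemma emb_himp:
  assumes "c \<in> carrier A" "d \<in> carrier A"
  shows "upsem worlds val (Var (Some (c \<rightarrow>\<^sub>H d))) =
    upsem worlds val (Imp (Var (Some c)) (Var (Some d)))"
proof -
  have *: "c \<rightarrow>\<^sub>H d \<in> x \<longleftrightarrow> (\<forall>w\<in>worlds. (x, y) \<le> w \<longrightarrow> c \<in> fst w \<longrightarrow> d \<in> fst w)"
    if w: "(x, y) \<in> worlds" for x y
  proof -
    have x: "prime_filter A x" using w by (simp add: worlds_def)
    show ?thesis
      unfolding prime_filter_himp[OF x assms]
    proof safe
      fix x' y' assume "\<forall>z. prime_filter A z \<longrightarrow> x \<subseteq> z \<longrightarrow> c \<in> z \<longrightarrow> d \<in> z"
        "(x', y') \<in> worlds" "(x, y) \<le> (x', y')" "c \<in> fst (x', y')"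
      then show "d \<in> fst (x', y')" by (auto simp: worlds_def)
    next
      fix z assume *: "\<forall>w\<in>worlds. (x, y) \<le> w \<longrightarrow> c \<in> fst w \<longrightarrow> d \<in> fst w"
        and z: "prime_filter A z" "x \<subseteq> z" "c \<in> z"
      obtain y' where "(z, y') \<in> worlds" "y \<subseteq> y'" using world_lift_fst[OF w z(1,2)] .
      then show "d \<in> z" using * z by force
    qed
  qed
  show ?thesis
  proof (rule Set.set_eqI)
    fix w
    show "w \<in> upsem worlds val (Var (Some (c \<rightarrow>\<^sub>H d))) \<longleftrightarrow>
      w \<in> upsem worlds val (Imp (Var (Some c)) (Var (Some d)))"
      using *[of "fst w" "snd w"] by auto
  qed
qed

text \<open>That every prime filter of \<open>A\<close> occurs in a world yields injectivity,
  through \<open>prime_le_iff\<close>. The operations are preserved world by world, implication by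
  \<open>emb_himp\<close>.\<close>

lemma heyting_embedding_emb:
  assumes "\<And>x. prime_filter A x \<Longrightarrow> \<exists>y. (x, y) \<in> worlds"
  shows "heyting_embedding A B emb"
  unfolding heyting_embedding_def
proof (intro conjI ballI)
  have pf: "prime_filter A x" if "(x, y) \<in> worlds" for x y
    using that by (simp add: worlds_def)
  show "emb \<in> carrier A \<rightarrow> carrier B" by (simp add: emb_def model.kripke_carrier)
  have le: "c \<sqsubseteq> d" if cd: "c \<in> carrier A" "d \<in> carrier A" "emb c = emb d" for c d
  proof -
    have "d \<in> x" if "prime_filter A x" "c \<in> x" for x
    proof -
      obtain y where "(x, y) \<in> worlds" using assms \<open>prime_filter A x\<close> by blast
      moreover have "worlds \<inter> val (Some c) = worlds \<inter> val (Some d)"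
        using cd(3) by (simp add: emb_def model.kcls_eq_iff)
      ultimately show ?thesis using \<open>c \<in> x\<close> by force
    qed
    then show ?thesis using cd by (simp add: prime_le_iff)
  qed
  show "inj_on emb (carrier A)"
    by (rule inj_onI) (use le in \<open>auto intro: le_antisym\<close>)
  show "emb \<bottom> = \<bottom>\<^bsub>B\<^esub>" "emb \<top> = \<top>\<^bsub>B\<^esub>"
    using prime_filter_bottom[OF pf] prime_filter_top[OF pf]
    by (auto simp: emb_def model.kripke_bottom model.kripke_top model.kcls_eq_iff)
  fix c d assume cd: "c \<in> carrier A" "d \<in> carrier A"
  show "emb (c \<sqinter> d) = emb c \<sqinter>\<^bsub>B\<^esub> emb d" "emb (c \<squnion> d) = emb c \<squnion>\<^bsub>B\<^esub> emb d"
    using prime_filter_meet[OF pf cd] prime_filter_join[OF pf cd]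
    by (auto simp: emb_def model.kripke_meet model.kripke_join model.kcls_eq_iff)
  show "emb (c \<rightarrow>\<^sub>H d) = emb c \<rightarrow>\<^sub>H\<^bsub>B\<^esub> emb d"
    unfolding emb_def model.kripke_himp model.kcls_eq_iff by (rule emb_himp[OF cd])
qed

text \<open>The variables of the tuple are interpreted through \<open>x\<close>, but the two
  components agree on them since they induce the same point of \<open>Es l\<close>. For implications
  \<open>world_lift_snd\<close> realises every \<open>y'\<close> above \<open>y\<close> in a larger
  world.\<close>

lemma upsem_system_iff:
  assumes "\<chi> \<in> formulas (Suc l)" "(x, y) \<in> worlds"
  shows "(x, y) \<in> upsem worlds val (map_fm (\<lambda>i. if i = l then None else Some (a i)) \<chi>) \<longleftrightarrow> cls \<chi> \<in> y"
    (is "_ \<in> ?S \<chi> \<longleftrightarrow> _")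
  using assms
proof (induction \<chi> arbitrary: x y)
  case (Var i)
  have w: "prime_filter A x" "y \<inter> carrier (free_heyting l) = pullback l A a x"
    using Var.prems(2) by (auto simp: worlds_def)
  have "a i \<in> x \<longleftrightarrow> cls (Var i) \<in> y" if "i < l"
  proof -
    have "cls (Var i) \<in> y \<longleftrightarrow> cls (Var i) \<in> y \<inter> carrier (free_heyting l)"
      using that by (auto simp: free_carrier)
    then show ?thesis
      using cls_in_pullback_iff[OF w(1) tuple_closed, of "Var i"] that by (simp add: w(2))
  qed
  then show ?case using Var.prems by auto
next
  case (Imp \<phi> \<psi>)
  have f: "\<phi> \<in> formulas (Suc l)" "\<psi> \<in> formulas (Suc l)" using Imp.prems by auto
  have y: "y \<in> Es (Suc l)" using Imp.prems by (simp add: worlds_def)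
  have "(x, y) \<in> ?S (Imp \<phi> \<psi>) \<longleftrightarrow>
     (\<forall>w\<in>worlds. (x, y) \<le> w \<longrightarrow> w \<in> ?S \<phi> \<longrightarrow> w \<in> ?S \<psi>)"
    using Imp.prems by simp
  also have "\<dots> \<longleftrightarrow> (\<forall>x' y'. (x', y') \<in> worlds \<longrightarrow> x \<subseteq> x' \<longrightarrow> y \<subseteq> y' \<longrightarrow> cls \<phi> \<in> y' \<longrightarrow> cls \<psi> \<in> y')"
    using Imp.IH f by (auto simp: Ball_def)
  also have "\<dots> \<longleftrightarrow> (\<forall>y'\<in>Es (Suc l). y \<subseteq> y' \<longrightarrow> cls \<phi> \<in> y' \<longrightarrow> cls \<psi> \<in> y')"
  proof (intro iffI ballI allI impI)
    fix y' assume *: "\<forall>x' y'. (x', y') \<in> worlds \<longrightarrow> x \<subseteq> x' \<longrightarrow> y \<subseteq> y' \<longrightarrow> cls \<phi> \<in> y' \<longrightarrow> cls \<psi> \<in> y'"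
      and y': "y' \<in> Es (Suc l)" "y \<subseteq> y'" "cls \<phi> \<in> y'"
    obtain x' where "(x', y') \<in> worlds" "x \<subseteq> x'"
      using world_lift_snd[OF Imp.prems(2) y'(1,2)] .
    with * y' show "cls \<psi> \<in> y'" by blast
  qed (auto simp: worlds_def)
  also have "\<dots> \<longleftrightarrow> cls (Imp \<phi> \<psi>) \<in> y" using Es_Imp[OF y f] by simp
  finally show ?case .
qed (auto simp: worlds_def Es_Top Es_Bot Es_And Es_Or)

text \<open>The solution is the class of \<open>Var None\<close>. The formula \<open>t\<close> is
  forced everywhere because each world has it in its second component, while each \<open>s k\<close>
  fails at some world.\<close>

lemma solvable_if_worlds:
  assumes lift: "\<And>x. prime_filter A x \<Longrightarrow> \<exists>y. (x, y) \<in> worlds"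
    and t: "t \<in> formulas (Suc l)"
    and s: "\<And>k. k \<in> {1..\<kappa>} \<Longrightarrow> s k \<in> formulas (Suc l) \<and> (\<exists>(x, y)\<in>worlds. cls (s k) \<notin> y)"
  shows "solvable_in_extension TYPE('a option fm set) A l a t \<kappa> s"
proof -
  let ?g = "\<lambda>i. if i = l then None else Some (a i)"
  have v: "(emb \<circ> a)(l := kcls worlds val (Var None)) = (\<lambda>i. kcls worlds val (Var (?g i)))"
    by (rule ext) (simp add: emb_def)
  have "ev B ((emb \<circ> a)(l := kcls worlds val (Var None))) t = \<top>\<^bsub>B\<^esub>"
    unfolding v model.ev_kripke model.kcls_eq_top_iff
    using upsem_system_iff[OF t] by (auto simp: worlds_def)
  moreover have "ev B ((emb \<circ> a)(l := kcls worlds val (Var None))) (s k) \<noteq> \<top>\<^bsub>B\<^esub>"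
    if k: "k \<in> {1..\<kappa>}" for k
    unfolding v model.ev_kripke model.kcls_eq_top_iff
    using upsem_system_iff[of "s k"] s[OF k] by blast
  moreover have "kcls worlds val (Var None) \<in> carrier B"
    by (simp add: model.kripke_carrier)
  ultimately have "solution B l (emb \<circ> a) t \<kappa> s (kcls worlds val (Var None))"
    unfolding solution_def by blast
  then show ?thesis
    unfolding solvable_in_extension_def
    using heyting_embedding_emb[OF lift] model.heyting_algebra_kripke by blast
qed

end

subsection \<open>Discriminant and co-discriminant\<close>

lemma ball_of_point:
  assumes "x \<in> Es l"
  obtains B where "B \<in> balls l R" "x \<in> B"
  using assms unfolding balls_eq_sim_classes by (auto simp: sim_def)

lemma sim_in_ball: "B \<in> balls l R \<Longrightarrow> x \<in> B \<Longrightarrow> y \<in> B \<Longrightarrow> sim l R x y"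
  unfolding balls_eq_sim_classes by (auto simp: sim_def)

lemma ball_formulas_mem_iff:
  assumes "ball_formulas l R \<phi> \<psi>" "B \<in> balls l R" "x \<in> Es l"
  shows "x \<in> B \<longleftrightarrow> cls (\<phi> B) \<in> x \<and> cls (\<psi> B) \<notin> x"
proof -
  have "B = truth_set l (\<phi> B) - truth_set l (\<psi> B)"
    using assms(1,2) unfolding ball_formulas_def by blast
  then have "x \<in> B \<longleftrightarrow> x \<in> truth_set l (\<phi> B) - truth_set l (\<psi> B)" by simp
  then show ?thesis using assms(3) by (simp add: truth_set_def)
qed

lemma ball_formulas_closed:
  assumes "ball_formulas l R \<phi> \<psi>" "B \<in> balls l R"
  shows "\<phi> B \<in> formulas l" "\<psi> B \<in> formulas l"
  using assms by (auto simp: ball_formulas_def)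

lemma (in heyting_algebra) ev_discriminant_eq_top_iff:
  assumes "ball_formulas l R \<phi> \<psi>" "v \<in> {..<l} \<rightarrow> carrier L"
  shows "ev L v (discriminant l R \<phi> \<psi> t) = \<top> \<longleftrightarrow>
    (\<forall>B\<in>balls l R. ipc (Imp (And t (\<phi> B)) (\<psi> B)) \<longrightarrow> ev L v (\<phi> B) \<sqsubseteq> ev L v (\<psi> B))"
  unfolding discriminant_def free_le_iff
  by (subst ev_big_and_eq_top_iff[OF assms(2)])
    (auto simp: finite_balls ball_formulas_closed[OF assms(1)] himp_eq_top_iff ev_closed[OF assms(2)])

lemma (in heyting_algebra) ev_codiscriminant_eq_top_iff:
  assumes "ball_formulas l R \<phi> \<psi>" "v \<in> {..<l} \<rightarrow> carrier L"
  shows "ev L v (codiscriminant l R \<phi> \<psi> t s) = \<top> \<longleftrightarrow>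
    (\<forall>B\<in>balls l R. \<not> ipc (Imp (And t (\<phi> B)) (Or s (\<psi> B))) \<longrightarrow> ev L v (\<phi> B) \<sqsubseteq> ev L v (\<psi> B))"
  unfolding codiscriminant_def free_le_iff
  by (subst ev_big_and_eq_top_iff[OF assms(2)])
    (auto simp: finite_balls ball_formulas_closed[OF assms(1)] himp_eq_top_iff ev_closed[OF assms(2)])

text \<open>By completeness some point \<open>x\<^sub>0\<close> of \<open>Es (Suc l)\<close>
  contains \<open>t\<close> and \<open>\<phi> B\<close> and omits \<open>s\<close> and
  \<open>\<psi> B\<close>. Its restriction lies in \<open>B\<close> together with \<open>z\<close>,
  so the lifting bound gives a point over \<open>z\<close> that agrees with \<open>x\<^sub>0\<close>
  up to degree \<open>d\<close>, in particular on \<open>t\<close> and \<open>s\<close>.\<close>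

lemma lift_point_of_ball:
  assumes R: "lifting_bound l d R" and bf: "ball_formulas l R \<phi> \<psi>"
    and B: "B \<in> balls l R" "z \<in> B" and z: "z \<in> Es l"
    and t: "t \<in> formulas (Suc l)" "degree t \<le> d" and s: "s \<in> formulas (Suc l)" "degree s \<le> d"
    and nle: "\<not> ipc (Imp (And t (\<phi> B)) (Or s (\<psi> B)))"
  obtains y where "y \<in> Es (Suc l)" "y \<inter> carrier (free_heyting l) = z" "cls t \<in> y" "cls s \<notin> y"
proof -
  note f = ball_formulas_closed[OF bf B(1)] and f' = ball_formulas_closed[OF bf B(1), THEN formulas_Suc]
  have "\<exists>x\<^sub>0\<in>Es (Suc l). cls (And t (\<phi> B)) \<in> x\<^sub>0 \<and> cls (Or s (\<psi> B)) \<notin> x\<^sub>0"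
    using nle ipc_Imp_iff_Es[of "And t (\<phi> B)" "Suc l" "Or s (\<psi> B)"] t s f' by auto
  then obtain x\<^sub>0 where x\<^sub>0: "x\<^sub>0 \<in> Es (Suc l)" "cls t \<in> x\<^sub>0" "cls (\<phi> B) \<in> x\<^sub>0"
    "cls s \<notin> x\<^sub>0" "cls (\<psi> B) \<notin> x\<^sub>0"
    using t s f' by (auto simp: Es_And Es_Or)
  let ?r = "x\<^sub>0 \<inter> carrier (free_heyting l)"
  have "?r \<in> B"
    using ball_formulas_mem_iff[OF bf B(1) restriction_in_Es[OF x\<^sub>0(1)]] x\<^sub>0 f
    by (simp add: free_carrier)
  then have "sim l R z ?r" using sim_in_ball B by blast
  then obtain y where y: "y \<in> Es (Suc l)" "y \<inter> carrier (free_heyting l) = z" "sim (Suc l) d y x\<^sub>0"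
    using R z x\<^sub>0(1) unfolding lifting_bound_def delta_less_iff by blast
  then have "cls t \<in> y" "cls s \<notin> y" using t s x\<^sub>0 by (auto simp: sim_def)
  then show thesis using that y by blast
qed

section \<open>Necessity of the conditions on the discriminants\<close>

lemma discriminants_if_solvable:
  fixes A :: "('a, 'm) gorder_scheme"
  assumes bf: "ball_formulas l R \<phi> \<psi>" and sys: "system_of_degree l d t \<kappa> s"
    and A: "heyting_algebra A" and a: "a \<in> {..<l} \<rightarrow> carrier A"
    and sol: "solvable_in_extension TYPE('b) A l a t \<kappa> s"
  shows "ev A a (discriminant l R \<phi> \<psi> t) = \<top>\<^bsub>A\<^esub> \<and>
    (\<forall>k\<in>{1..\<kappa>}. ev A a (codiscriminant l R \<phi> \<psi> t (s k)) \<noteq> \<top>\<^bsub>A\<^esub>)"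
proof -
  obtain B :: "'b gorder" and f b where B: "heyting_algebra B" and emb: "heyting_embedding A B f"
    and "solution B l (f \<circ> a) t \<kappa> s b"
    using sol unfolding solvable_in_extension_def by blast
  then have b: "b \<in> carrier B" and tb: "ev B ((f \<circ> a)(l := b)) t = \<top>\<^bsub>B\<^esub>"
    and sb: "\<And>k. k \<in> {1..\<kappa>} \<Longrightarrow> ev B ((f \<circ> a)(l := b)) (s k) \<noteq> \<top>\<^bsub>B\<^esub>"
    by (auto simp: solution_def)
  interpret A: heyting_algebra A by (rule A)
  interpret B: heyting_algebra B by (rule B)
  have fc: "f c \<in> carrier B" if "c \<in> carrier A" for c
    using emb that by (auto simp: heyting_embedding_def)
  have inj: "inj_on f (carrier A)" and ftop: "f \<top>\<^bsub>A\<^esub> = \<top>\<^bsub>B\<^esub>"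
    and fimp: "\<And>c d. c \<in> carrier A \<Longrightarrow> d \<in> carrier A \<Longrightarrow> f (c \<rightarrow>\<^sub>H\<^bsub>A\<^esub> d) = f c \<rightarrow>\<^sub>H\<^bsub>B\<^esub> f d"
    using emb by (auto simp: heyting_embedding_def)
  \<comment> \<open>The order is expressed by implication and top, which \<open>f\<close> preserves;
    injectivity then makes \<open>f\<close> reflect it too.\<close>
  have f_le: "c \<sqsubseteq>\<^bsub>A\<^esub> d \<longleftrightarrow> f c \<sqsubseteq>\<^bsub>B\<^esub> f d" if "c \<in> carrier A" "d \<in> carrier A" for c d
  proof -
    have "c \<sqsubseteq>\<^bsub>A\<^esub> d \<longleftrightarrow> f (c \<rightarrow>\<^sub>H\<^bsub>A\<^esub> d) = f \<top>\<^bsub>A\<^esub>"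
      using that inj by (simp add: inj_on_eq_iff A.himp_eq_top_iff)
    then show ?thesis
      using that by (simp add: fimp ftop fc B.himp_eq_top_iff)
  qed
  define v where "v = (f \<circ> a)(l := b)"
  note tb = tb[folded v_def] and sb = sb[folded v_def]
  have v: "v \<in> {..<Suc l} \<rightarrow> carrier B"
    using a b by (auto simp: v_def less_Suc_eq Pi_iff intro!: fc)
  \<comment> \<open>The unknown has index \<open>l\<close>, so the update of the tuple at
    \<open>l\<close> is invisible to formulas with variables below \<open>l\<close>.\<close>
  have ev_v: "ev B v \<chi> = f (ev A a \<chi>)" if "\<chi> \<in> formulas l" for \<chi>
    using that
  proof (induction \<chi>)
    case (Var i)
    then show ?case by (simp add: v_def)
  qed (use emb A.ev_closed[OF a] in \<open>auto simp: heyting_embedding_def\<close>)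
  have le_v: "ev A a \<chi> \<sqsubseteq>\<^bsub>A\<^esub> ev A a \<theta> \<longleftrightarrow> ev B v \<chi> \<sqsubseteq>\<^bsub>B\<^esub> ev B v \<theta>"
    if "\<chi> \<in> formulas l" "\<theta> \<in> formulas l" for \<chi> \<theta>
    using that A.ev_closed[OF a] by (simp add: f_le ev_v)
  note fm = ball_formulas_closed[OF bf]
  have t: "t \<in> formulas (Suc l)" using sys by (simp add: system_of_degree_def)
  have "ev A a (\<phi> C) \<sqsubseteq>\<^bsub>A\<^esub> ev A a (\<psi> C)"
    if C: "C \<in> balls l R" "ipc (Imp (And t (\<phi> C)) (\<psi> C))" for C
  proof -
    have "ev B v (And t (\<phi> C)) \<sqsubseteq>\<^bsub>B\<^esub> ev B v (\<psi> C)"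
      by (rule B.ev_mono[OF C(2) _ _ v]) (use t fm[OF C(1)] in \<open>auto intro: formulas_Suc\<close>)
    \<comment> \<open>Since \<open>t\<close> takes the value top, it drops out of the conjunction
      with \<open>\<phi> C\<close>.\<close>
    moreover have "\<top>\<^bsub>B\<^esub> \<sqinter>\<^bsub>B\<^esub> ev B v (\<phi> C) = ev B v (\<phi> C)"
      using B.ev_closed[OF v formulas_Suc[OF fm(1)[OF C(1)]]] by (intro B.meet_eqI) auto
    ultimately show ?thesis using tb fm[OF C(1)] by (simp add: le_v)
  qed
  moreover have "ev A a (codiscriminant l R \<phi> \<psi> t (s k)) \<noteq> \<top>\<^bsub>A\<^esub>" if k: "k \<in> {1..\<kappa>}" for k
  proof -
    have sk: "s k \<in> formulas (Suc l)" using sys k by (simp add: system_of_degree_def)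
    have "\<not> \<top>\<^bsub>B\<^esub> \<sqsubseteq>\<^bsub>B\<^esub> ev B v (s k)"
      using sb[OF k] B.ev_closed[OF v sk] by (simp add: B.eq_top_iff)
    then obtain x where x: "prime_filter B x" "ev B v (s k) \<notin> x" "\<top>\<^bsub>B\<^esub> \<in> x"
      using B.prime_le_iff[OF B.top_closed B.ev_closed[OF v sk]] by blast
    define y where "y = pullback (Suc l) B v x"
    have y: "y \<in> Es (Suc l)" unfolding y_def by (rule B.pullback_in_Es[OF x(1) v])
    have mem: "cls \<chi> \<in> y \<longleftrightarrow> ev B v \<chi> \<in> x" if "\<chi> \<in> formulas (Suc l)" for \<chi>
      unfolding y_def by (rule B.cls_in_pullback_iff[OF x(1) v that])
    note z = restriction_in_Es[OF y]
    obtain C where C: "C \<in> balls l R" "y \<inter> carrier (free_heyting l) \<in> C"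
      using ball_of_point[OF z] .
    note f = fm[OF C(1)] and f' = fm[OF C(1), THEN formulas_Suc]
    have \<phi>\<psi>: "cls (\<phi> C) \<in> y" "cls (\<psi> C) \<notin> y"
      using ball_formulas_mem_iff[OF bf C(1) z] C(2) f by (auto simp: free_carrier)
    have "cls (And t (\<phi> C)) \<in> y" "cls (Or (s k) (\<psi> C)) \<notin> y"
      using y t sk f' \<phi>\<psi> x tb mem[OF t] mem[OF sk] by (simp_all add: Es_And Es_Or)
    \<comment> \<open>\<open>y\<close> shows that the ball \<open>C\<close> contributes to the
      co-discriminant, and \<open>x\<close> shows that its conjunct is not top.\<close>
    then have "\<not> ipc (Imp (And t (\<phi> C)) (Or (s k) (\<psi> C)))"
      using Es_mono[OF y] sk f' by auto
    moreover have "\<not> ev B v (\<phi> C) \<sqsubseteq>\<^bsub>B\<^esub> ev B v (\<psi> C)"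
      using \<phi>\<psi> mem f' B.prime_filterD(2)[OF x(1)] B.ev_closed[OF v] by blast
    ultimately show ?thesis
      using C(1) f by (auto simp: A.ev_codiscriminant_eq_top_iff[OF bf a] le_v)
  qed
  ultimately show ?thesis
    by (simp add: A.ev_discriminant_eq_top_iff[OF bf a])
qed

section \<open>Sufficiency of the conditions on the discriminants\<close>

lemma solvable_if_discriminants:
  fixes A :: "('a, 'm) gorder_scheme"
  assumes R: "lifting_bound l d R" and bf: "ball_formulas l R \<phi> \<psi>"
    and sys: "system_of_degree l d t \<kappa> s"
    and A: "heyting_algebra A" and a: "a \<in> {..<l} \<rightarrow> carrier A"
    and disc: "ev A a (discriminant l R \<phi> \<psi> t) = \<top>\<^bsub>A\<^esub>"
    and codisc: "\<forall>k\<in>{1..\<kappa>}. ev A a (codiscriminant l R \<phi> \<psi> t (s k)) \<noteq> \<top>\<^bsub>A\<^esub>"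
  shows "solvable_in_extension TYPE('a option fm set) A l a t \<kappa> s"
proof -
  interpret tuple_equation A l a t
    using A a by (simp add: tuple_equation_def tuple_equation_axioms_def)
  have t: "t \<in> formulas (Suc l)" "degree t \<le> d" using sys by (auto simp: system_of_degree_def)
  note cl = ev_closed[OF a] and fm = ball_formulas_closed[OF bf]
  have ball_iff: "pullback l A a x \<in> C \<longleftrightarrow> ev A a (\<phi> C) \<in> x \<and> ev A a (\<psi> C) \<notin> x"
    if "prime_filter A x" "C \<in> balls l R" for x C
    using ball_formulas_mem_iff[OF bf that(2) pullback_in_Es[OF that(1) a]]
      cls_in_pullback_iff[OF that(1) a] fm[OF that(2)] by simp
  show ?thesis
  proof (rule solvable_if_worlds[OF _ t(1)])
    fix x assume x: "prime_filter A x"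
    note z = pullback_in_Es[OF x a]
    obtain C where C: "C \<in> balls l R" "pullback l A a x \<in> C" using ball_of_point[OF z] .
    \<comment> \<open>\<open>x\<close> contains the value of \<open>\<phi> C\<close> but not that of
      \<open>\<psi> C\<close>. As the discriminant takes the value top, \<open>C\<close> cannot be
      one of its balls.\<close>
    have "\<not> ev A a (\<phi> C) \<sqsubseteq>\<^bsub>A\<^esub> ev A a (\<psi> C)"
      using ball_iff[OF x C(1)] C(2) prime_filterD(2)[OF x] cl fm[OF C(1)] by blast
    then have "\<not> ipc (Imp (And t (\<phi> C)) (\<psi> C))"
      using disc C(1) ev_discriminant_eq_top_iff[OF bf a] by blast
    \<comment> \<open>Only \<open>t\<close> has to be controlled here, so
      \<open>lift_point_of_ball\<close> is used with \<open>Bot\<close> in place of the formula to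
      be omitted.\<close>
    moreover have "ipc (Imp (Or Bot (\<psi> C)) (\<psi> C))" by (simp add: ipc_Or BotE ipc_refl)
    ultimately have "\<not> ipc (Imp (And t (\<phi> C)) (Or Bot (\<psi> C)))" using ipc_trans by blast
    then obtain y where "y \<in> Es (Suc l)" "y \<inter> carrier (free_heyting l) = pullback l A a x" "cls t \<in> y"
      using lift_point_of_ball[OF R bf C z t, of Bot] formulas_simps(1) degree.simps(2) le0 by metis
    then show "\<exists>y. (x, y) \<in> worlds" using x by (auto simp: worlds_def)
  next
    fix k assume k: "k \<in> {1..\<kappa>}"
    have sk: "s k \<in> formulas (Suc l)" "degree (s k) \<le> d"
      using sys k by (auto simp: system_of_degree_def)
    \<comment> \<open>A conjunct of the co-discriminant that is not top selects \<open>C\<close>. A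
      prime filter \<open>x\<close> of \<open>A\<close> witnessing this has its pullback in
      \<open>C\<close>, and over that pullback there is a point that contains \<open>t\<close> and
      omits \<open>s k\<close>.\<close>
    obtain C where C: "C \<in> balls l R" "\<not> ipc (Imp (And t (\<phi> C)) (Or (s k) (\<psi> C)))"
      "\<not> ev A a (\<phi> C) \<sqsubseteq>\<^bsub>A\<^esub> ev A a (\<psi> C)"
      using codisc k ev_codiscriminant_eq_top_iff[OF bf a] by blast
    obtain x where x: "prime_filter A x" "ev A a (\<phi> C) \<in> x" "ev A a (\<psi> C) \<notin> x"
      using C(3) prime_le_iff[OF cl cl, OF fm[OF C(1)]] by blast
    have "pullback l A a x \<in> C" using ball_iff[OF x(1) C(1)] x by blast
    then obtain y where "y \<in> Es (Suc l)" "y \<inter> carrier (free_heyting l) = pullback l A a x"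
      "cls t \<in> y" "cls (s k) \<notin> y"
      using lift_point_of_ball[OF R bf C(1) _ pullback_in_Es[OF x(1) a] t sk C(2)] by blast
    then show "s k \<in> formulas (Suc l) \<and> (\<exists>(x, y)\<in>worlds. cls (s k) \<notin> y)"
      using x sk by (auto simp: worlds_def)
  qed
qed

theorem theorem6p1:
  fixes A :: "('a, 'm) gorder_scheme"
    and a :: "nat \<Rightarrow> 'a"
    and l d R \<kappa> :: nat
    and \<phi> \<psi> :: "nat fm set set set \<Rightarrow> nat fm"
    and t :: "nat fm"
    and s :: "nat \<Rightarrow> nat fm"
  assumes "lifting_bound l d R"
    and "ball_formulas l R \<phi> \<psi>"
    and "system_of_degree l d t \<kappa> s"
    and "heyting_algebra A"
    and "a \<in> {..<l} \<rightarrow> carrier A"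
  shows "(solvable_in_extension TYPE('a option fm set) A l a t \<kappa> s \<longleftrightarrow>
            ev A a (discriminant l R \<phi> \<psi> t) = \<top>\<^bsub>A\<^esub> \<and>
            (\<forall>k\<in>{1..\<kappa>}. ev A a (codiscriminant l R \<phi> \<psi> t (s k)) \<noteq> \<top>\<^bsub>A\<^esub>))
       \<and> (solvable_in_extension TYPE('b) A l a t \<kappa> s \<longrightarrow>
            ev A a (discriminant l R \<phi> \<psi> t) = \<top>\<^bsub>A\<^esub> \<and>
            (\<forall>k\<in>{1..\<kappa>}. ev A a (codiscriminant l R \<phi> \<psi> t (s k)) \<noteq> \<top>\<^bsub>A\<^esub>))"
  \<comment> \<open>Necessity is instantiated twice, at the type of the constructed extension for
    the equivalence and at an arbitrary type for the second conjunct.\<close>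
  using discriminants_if_solvable[where 'b = "'a option fm set", OF assms(2-5)]
    discriminants_if_solvable[where 'b = 'b, OF assms(2-5)] solvable_if_discriminants[OF assms]
  by blast

end
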